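(* The following is provable in ZF (without the Axiom of Choice): $UT(\aleph_0,\aleph_0,\aleph_0)$ implies $\mathcal{P}_{lc,c}$, and $\mathcal{P}_{lc,c}$ implies $AC_{\aleph_0}^{\aleph_0}$.
   Context: A graph is locally countable if for every vertex $v$ the set of neighbors of $v$ is countable (finite or countably infinite); it is connected if any two vertices are joined by a path of finite length. An independent set in a graph is a set of vertices no two of which are joined by an edge; a maximal independent set is an independent set that is not properly contained in any other independent set. $UT(\aleph_0,\aleph_0,\aleph_0)$: if a set $A$ and every member of $A$ have cardinality $\aleph_0$, then $|\bigcup A|=\aleph_0$. $\mathcal{P}_{lc,c}$: every locally countable connected graph has a maximal independent set. $AC_{\aleph_0}^{\aleph_0}$: every denumerable (i.e. countably infinite) family of denumerable sets has a choice function. *)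

theory Defs
  imports Main
begin

text \<open>
  Isabelle/HOL itself proves the axiom of choice, so provability in ZF is stated through a deep
  embedding: first-order formulas over membership and equality, a derivability relation for
  classical first-order logic, and the axioms of ZF as a set of sentences.
\<close>

section \<open>First-order logic with equality over the language of set theory\<close>

text \<open>Variables are de Bruijn indices; the only terms of the language are variables.\<close>

datatype fm =
    Mem nat nat
  | Eq nat nat
  | Falsity
  | Imp fm fm
  | Forall fm

fun fv :: "fm \<Rightarrow> nat set" where
  "fv (Mem i j) = {i, j}"
| "fv (Eq i j) = {i, j}"
| "fv Falsity = {}"
| "fv (Imp p q) = fv p \<union> fv q"
| "fv (Forall p) = {i. Suc i \<in> fv p}"

text \<open>Simultaneous (capture-avoiding) replacement of the free variables.\<close>

fun ren :: "(nat \<Rightarrow> nat) \<Rightarrow> fm \<Rightarrow> fm" where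
  "ren f (Mem i j) = Mem (f i) (f j)"
| "ren f (Eq i j) = Eq (f i) (f j)"
| "ren f Falsity = Falsity"
| "ren f (Imp p q) = Imp (ren f p) (ren f q)"
| "ren f (Forall p) = Forall (ren (case_nat 0 (\<lambda>i. Suc (f i))) p)"

definition inst :: "nat \<Rightarrow> fm \<Rightarrow> fm" where
  "inst t p = ren (case_nat t (\<lambda>i. i)) p"

text \<open>
  Natural deduction. In the rule \<open>AllI\<close>, shifting the hypotheses makes the variable with index 0
  fresh for them. Sets of hypotheses may be infinite, but each derivation is a finite tree.
\<close>

inductive derivable :: "fm set \<Rightarrow> fm \<Rightarrow> bool" (infix "\<turnstile>" 50) where
  Assm: "p \<in> H \<Longrightarrow> H \<turnstile> p"
| ImpI: "insert p H \<turnstile> q \<Longrightarrow> H \<turnstile> Imp p q"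
| ImpE: "H \<turnstile> Imp p q \<Longrightarrow> H \<turnstile> p \<Longrightarrow> H \<turnstile> q"
| Classical: "insert (Imp p Falsity) H \<turnstile> Falsity \<Longrightarrow> H \<turnstile> p"
| AllI: "ren Suc ` H \<turnstile> p \<Longrightarrow> H \<turnstile> Forall p"
| AllE: "H \<turnstile> Forall p \<Longrightarrow> H \<turnstile> inst t p"
| EqRefl: "H \<turnstile> Eq t t"
| EqSubst: "H \<turnstile> Eq s t \<Longrightarrow> H \<turnstile> inst s p \<Longrightarrow> H \<turnstile> inst t p"


section \<open>Writing formulas with named variables\<close>

text \<open>
  A value of type \<open>form\<close> maps the number \<open>d\<close> of enclosing quantifiers to a formula. A variable is
  represented by the level of its quantifier, that is, the number of quantifiers enclosing that
  quantifier; below \<open>d\<close> quantifiers the level \<open>x < d\<close> is the de Bruijn index \<open>d - 1 - x\<close>. So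
  formulas can be written with HOL-bound names and without explicit shifting of indices, and
  applying a closed \<open>form\<close> to 0 yields the sentence it denotes.
\<close>

type_synonym form = "nat \<Rightarrow> fm"

definition f_mem :: "nat \<Rightarrow> nat \<Rightarrow> form" (infix "\<^bold>\<in>" 50) where
  "x \<^bold>\<in> y = (\<lambda>d. Mem (d - 1 - x) (d - 1 - y))"

definition f_eq :: "nat \<Rightarrow> nat \<Rightarrow> form" (infix "\<^bold>=" 50) where
  "x \<^bold>= y = (\<lambda>d. Eq (d - 1 - x) (d - 1 - y))"

definition f_imp :: "form \<Rightarrow> form \<Rightarrow> form" (infixr "\<^bold>\<longrightarrow>" 25) where
  "(p \<^bold>\<longrightarrow> q) = (\<lambda>d. Imp (p d) (q d))"

definition f_not :: "form \<Rightarrow> form" ("\<^bold>\<not> _" [40] 40) where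
  "(\<^bold>\<not> p) = (\<lambda>d. Imp (p d) Falsity)"

definition f_or :: "form \<Rightarrow> form \<Rightarrow> form" (infixr "\<^bold>\<or>" 30) where
  "(p \<^bold>\<or> q) = (\<^bold>\<not> p \<^bold>\<longrightarrow> q)"

definition f_and :: "form \<Rightarrow> form \<Rightarrow> form" (infixr "\<^bold>\<and>" 35) where
  "(p \<^bold>\<and> q) = (\<^bold>\<not> (p \<^bold>\<longrightarrow> \<^bold>\<not> q))"

definition f_iff :: "form \<Rightarrow> form \<Rightarrow> form" (infixr "\<^bold>\<longleftrightarrow>" 25) where
  "(p \<^bold>\<longleftrightarrow> q) = ((p \<^bold>\<longrightarrow> q) \<^bold>\<and> (q \<^bold>\<longrightarrow> p))"

definition f_all :: "(nat \<Rightarrow> form) \<Rightarrow> form" (binder "\<^bold>\<forall>" 10) where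
  "f_all F = (\<lambda>d. Forall (F d (Suc d)))"

definition f_ex :: "(nat \<Rightarrow> form) \<Rightarrow> form" (binder "\<^bold>\<exists>" 10) where
  "f_ex F = (\<^bold>\<not> (\<^bold>\<forall>x. \<^bold>\<not> F x))"

text \<open>\<open>f_app p [x\<^sub>0, \<dots>, x\<^sub>k]\<close> is \<open>p(x\<^sub>0, \<dots>, x\<^sub>k)\<close>: index \<open>i\<close> of \<open>p\<close> becomes the variable \<open>x\<^sub>i\<close>.\<close>

definition f_app :: "fm \<Rightarrow> nat list \<Rightarrow> form" where
  "f_app p xs = (\<lambda>d. ren (\<lambda>i. d - 1 - xs ! i) p)"


section \<open>The axioms of ZF\<close>

definition f_subset :: "nat \<Rightarrow> nat \<Rightarrow> form" (infix "\<^bold>\<subseteq>" 50) where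
  "x \<^bold>\<subseteq> y = (\<^bold>\<forall>z. z \<^bold>\<in> x \<^bold>\<longrightarrow> z \<^bold>\<in> y)"

definition is_empty :: "nat \<Rightarrow> form" where
  "is_empty x = (\<^bold>\<forall>z. \<^bold>\<not> z \<^bold>\<in> x)"

definition is_upair :: "nat \<Rightarrow> nat \<Rightarrow> nat \<Rightarrow> form" where
  "is_upair x y p = (\<^bold>\<forall>z. z \<^bold>\<in> p \<^bold>\<longleftrightarrow> z \<^bold>= x \<^bold>\<or> z \<^bold>= y)"

definition is_Union :: "nat \<Rightarrow> nat \<Rightarrow> form" where
  "is_Union A u = (\<^bold>\<forall>z. z \<^bold>\<in> u \<^bold>\<longleftrightarrow> (\<^bold>\<exists>a. a \<^bold>\<in> A \<^bold>\<and> z \<^bold>\<in> a))"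

definition is_succ :: "nat \<Rightarrow> nat \<Rightarrow> form" where
  "is_succ x s = (\<^bold>\<forall>z. z \<^bold>\<in> s \<^bold>\<longleftrightarrow> z \<^bold>\<in> x \<^bold>\<or> z \<^bold>= x)"

definition is_inductive :: "nat \<Rightarrow> form" where
  "is_inductive w =
    ((\<^bold>\<exists>e. e \<^bold>\<in> w \<^bold>\<and> is_empty e) \<^bold>\<and>
     (\<^bold>\<forall>x. x \<^bold>\<in> w \<^bold>\<longrightarrow> (\<^bold>\<exists>s. s \<^bold>\<in> w \<^bold>\<and> is_succ x s)))"

definition Extensionality :: fm where
  "Extensionality = (\<^bold>\<forall>x. \<^bold>\<forall>y. (\<^bold>\<forall>z. z \<^bold>\<in> x \<^bold>\<longleftrightarrow> z \<^bold>\<in> y) \<^bold>\<longrightarrow> x \<^bold>= y) 0"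

definition Foundation :: fm where
  "Foundation =
    (\<^bold>\<forall>x. \<^bold>\<not> is_empty x \<^bold>\<longrightarrow> (\<^bold>\<exists>y. y \<^bold>\<in> x \<^bold>\<and> \<^bold>\<not> (\<^bold>\<exists>z. z \<^bold>\<in> x \<^bold>\<and> z \<^bold>\<in> y))) 0"

definition Pairing :: fm where
  "Pairing = (\<^bold>\<forall>x. \<^bold>\<forall>y. \<^bold>\<exists>p. is_upair x y p) 0"

definition Union_axiom :: fm where
  "Union_axiom = (\<^bold>\<forall>A. \<^bold>\<exists>u. is_Union A u) 0"

definition Power_set :: fm where
  "Power_set = (\<^bold>\<forall>x. \<^bold>\<exists>p. \<^bold>\<forall>z. z \<^bold>\<in> p \<^bold>\<longleftrightarrow> z \<^bold>\<subseteq> x) 0"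

definition Infinity :: fm where
  "Infinity = (\<^bold>\<exists>w. is_inductive w) 0"

text \<open>
  The schemata, for a formula with \<open>n\<close> parameters. The parameters are universally quantified first
  and so have the levels \<open>0, \<dots>, n - 1\<close>; the remaining formula is placed below these \<open>n\<close> quantifiers.
\<close>

definition Separation :: "nat \<Rightarrow> fm \<Rightarrow> fm" where
  "Separation n p = (Forall ^^ n)
    ((\<^bold>\<forall>a. \<^bold>\<exists>b. \<^bold>\<forall>x. x \<^bold>\<in> b \<^bold>\<longleftrightarrow> x \<^bold>\<in> a \<^bold>\<and> f_app p ([x, a] @ [0..<n])) n)"

definition Replacement :: "nat \<Rightarrow> fm \<Rightarrow> fm" where
  "Replacement n p = (Forall ^^ n)
    ((\<^bold>\<forall>a.
       (\<^bold>\<forall>x. \<^bold>\<forall>y. \<^bold>\<forall>z. x \<^bold>\<in> a \<^bold>\<and> f_app p ([x, y, a] @ [0..<n]) \<^bold>\<and> f_app p ([x, z, a] @ [0..<n])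
          \<^bold>\<longrightarrow> y \<^bold>= z) \<^bold>\<longrightarrow>
       (\<^bold>\<exists>b. \<^bold>\<forall>y. y \<^bold>\<in> b \<^bold>\<longleftrightarrow> (\<^bold>\<exists>x. x \<^bold>\<in> a \<^bold>\<and> f_app p ([x, y, a] @ [0..<n])))) n)"

definition ZF :: "fm set" where
  "ZF = {Extensionality, Foundation, Pairing, Union_axiom, Power_set, Infinity}
    \<union> {Separation n p | n p. fv p \<subseteq> {..<n + 2}}
    \<union> {Replacement n p | n p. fv p \<subseteq> {..<n + 3}}"


section \<open>Functions and cardinality\<close>

text \<open>\<open>p\<close> is the Kuratowski pair of \<open>x\<close> and \<open>y\<close>.\<close>

definition is_opair :: "nat \<Rightarrow> nat \<Rightarrow> nat \<Rightarrow> form" where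
  "is_opair x y p = (\<^bold>\<exists>u. \<^bold>\<exists>v. is_upair x x u \<^bold>\<and> is_upair x y v \<^bold>\<and> is_upair u v p)"

definition maps_to :: "nat \<Rightarrow> nat \<Rightarrow> nat \<Rightarrow> form" where
  "maps_to f x y = (\<^bold>\<exists>p. is_opair x y p \<^bold>\<and> p \<^bold>\<in> f)"

definition is_function :: "nat \<Rightarrow> nat \<Rightarrow> nat \<Rightarrow> form" where
  "is_function f a b =
    ((\<^bold>\<forall>p. p \<^bold>\<in> f \<^bold>\<longrightarrow> (\<^bold>\<exists>x. \<^bold>\<exists>y. x \<^bold>\<in> a \<^bold>\<and> y \<^bold>\<in> b \<^bold>\<and> is_opair x y p)) \<^bold>\<and>
     (\<^bold>\<forall>x. x \<^bold>\<in> a \<^bold>\<longrightarrow> (\<^bold>\<exists>y. maps_to f x y \<^bold>\<and> (\<^bold>\<forall>z. maps_to f x z \<^bold>\<longrightarrow> z \<^bold>= y))))"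

definition is_injection :: "nat \<Rightarrow> nat \<Rightarrow> nat \<Rightarrow> form" where
  "is_injection f a b =
    (is_function f a b \<^bold>\<and>
     (\<^bold>\<forall>x. \<^bold>\<forall>z. \<^bold>\<forall>y. maps_to f x y \<^bold>\<and> maps_to f z y \<^bold>\<longrightarrow> x \<^bold>= z))"

definition is_bijection :: "nat \<Rightarrow> nat \<Rightarrow> nat \<Rightarrow> form" where
  "is_bijection f a b =
    (is_injection f a b \<^bold>\<and> (\<^bold>\<forall>y. y \<^bold>\<in> b \<^bold>\<longrightarrow> (\<^bold>\<exists>x. x \<^bold>\<in> a \<^bold>\<and> maps_to f x y)))"

definition is_omega :: "nat \<Rightarrow> form" where
  "is_omega w = (is_inductive w \<^bold>\<and> (\<^bold>\<forall>x. is_inductive x \<^bold>\<longrightarrow> w \<^bold>\<subseteq> x))"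

definition is_finite :: "nat \<Rightarrow> form" where
  "is_finite a = (\<^bold>\<exists>w. \<^bold>\<exists>n. \<^bold>\<exists>f. is_omega w \<^bold>\<and> n \<^bold>\<in> w \<^bold>\<and> is_bijection f n a)"

definition is_denumerable :: "nat \<Rightarrow> form" where
  "is_denumerable a = (\<^bold>\<exists>w. \<^bold>\<exists>f. is_omega w \<^bold>\<and> is_bijection f w a)"

definition is_countable :: "nat \<Rightarrow> form" where
  "is_countable a = (is_finite a \<^bold>\<or> is_denumerable a)"


section \<open>Graphs\<close>

text \<open>Simple undirected graphs with vertex set \<open>V\<close> and edge set \<open>E\<close>.\<close>

definition is_graph :: "nat \<Rightarrow> nat \<Rightarrow> form" where
  "is_graph V E =
    (\<^bold>\<forall>e. e \<^bold>\<in> E \<^bold>\<longrightarrow> (\<^bold>\<exists>x. \<^bold>\<exists>y. x \<^bold>\<in> V \<^bold>\<and> y \<^bold>\<in> V \<^bold>\<and> \<^bold>\<not> x \<^bold>= y \<^bold>\<and> is_upair x y e))"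

definition adjacent :: "nat \<Rightarrow> nat \<Rightarrow> nat \<Rightarrow> form" where
  "adjacent E x y = (\<^bold>\<exists>e. e \<^bold>\<in> E \<^bold>\<and> is_upair x y e)"

definition locally_countable :: "nat \<Rightarrow> nat \<Rightarrow> form" where
  "locally_countable V E =
    (\<^bold>\<forall>v. v \<^bold>\<in> V \<^bold>\<longrightarrow>
      (\<^bold>\<forall>N. (\<^bold>\<forall>x. x \<^bold>\<in> N \<^bold>\<longleftrightarrow> x \<^bold>\<in> V \<^bold>\<and> adjacent E v x) \<^bold>\<longrightarrow> is_countable N))"

text \<open>
  A path of length \<open>n\<close> from \<open>x\<close> to \<open>y\<close>: an injective sequence of vertices indexed by
  \<open>n + 1 = {0, \<dots>, n}\<close>, the numbers being von Neumann numerals.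
\<close>

definition is_path :: "nat \<Rightarrow> nat \<Rightarrow> nat \<Rightarrow> nat \<Rightarrow> nat \<Rightarrow> nat \<Rightarrow> form" where
  "is_path V E n p x y =
    ((\<^bold>\<exists>m. is_succ n m \<^bold>\<and> is_injection p m V) \<^bold>\<and>
     (\<^bold>\<exists>z. is_empty z \<^bold>\<and> maps_to p z x) \<^bold>\<and>
     maps_to p n y \<^bold>\<and>
     (\<^bold>\<forall>i. \<^bold>\<forall>j. \<^bold>\<forall>u. \<^bold>\<forall>v.
        i \<^bold>\<in> n \<^bold>\<and> is_succ i j \<^bold>\<and> maps_to p i u \<^bold>\<and> maps_to p j v \<^bold>\<longrightarrow> adjacent E u v))"

definition is_connected :: "nat \<Rightarrow> nat \<Rightarrow> form" where
  "is_connected V E =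
    (\<^bold>\<forall>x. \<^bold>\<forall>y. x \<^bold>\<in> V \<^bold>\<and> y \<^bold>\<in> V \<^bold>\<longrightarrow>
      (\<^bold>\<exists>w. \<^bold>\<exists>n. \<^bold>\<exists>p. is_omega w \<^bold>\<and> n \<^bold>\<in> w \<^bold>\<and> is_path V E n p x y))"

definition is_independent :: "nat \<Rightarrow> nat \<Rightarrow> nat \<Rightarrow> form" where
  "is_independent V E I =
    (I \<^bold>\<subseteq> V \<^bold>\<and> (\<^bold>\<forall>x. \<^bold>\<forall>y. x \<^bold>\<in> I \<^bold>\<and> y \<^bold>\<in> I \<^bold>\<longrightarrow> \<^bold>\<not> adjacent E x y))"

definition is_maximal_independent :: "nat \<Rightarrow> nat \<Rightarrow> nat \<Rightarrow> form" where
  "is_maximal_independent V E I =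
    (is_independent V E I \<^bold>\<and>
     \<^bold>\<not> (\<^bold>\<exists>J. is_independent V E J \<^bold>\<and> I \<^bold>\<subseteq> J \<^bold>\<and> \<^bold>\<not> I \<^bold>= J))"


section \<open>The three principles\<close>

definition UT_aleph0 :: fm where
  "UT_aleph0 =
    (\<^bold>\<forall>A. is_denumerable A \<^bold>\<and> (\<^bold>\<forall>a. a \<^bold>\<in> A \<^bold>\<longrightarrow> is_denumerable a) \<^bold>\<longrightarrow>
      (\<^bold>\<forall>u. is_Union A u \<^bold>\<longrightarrow> is_denumerable u)) 0"

definition P_lc_c :: fm where
  "P_lc_c =
    (\<^bold>\<forall>V. \<^bold>\<forall>E. is_graph V E \<^bold>\<and> locally_countable V E \<^bold>\<and> is_connected V E \<^bold>\<longrightarrow>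
      (\<^bold>\<exists>I. is_maximal_independent V E I)) 0"

definition AC_aleph0_aleph0 :: fm where
  "AC_aleph0_aleph0 =
    (\<^bold>\<forall>A. is_denumerable A \<^bold>\<and> (\<^bold>\<forall>a. a \<^bold>\<in> A \<^bold>\<longrightarrow> is_denumerable a) \<^bold>\<longrightarrow>
      (\<^bold>\<exists>f. \<^bold>\<exists>u. is_Union A u \<^bold>\<and> is_function f A u \<^bold>\<and>
        (\<^bold>\<forall>a. \<^bold>\<forall>y. a \<^bold>\<in> A \<^bold>\<and> maps_to f a y \<^bold>\<longrightarrow> y \<^bold>\<in> a))) 0"

end

theory Submission
  imports Defs "HOL-Library.Countable" "HOL-Library.Infinite_Set"
begin

text \<open>
  By the completeness theorem it suffices to argue in an arbitrary model of ZF, where separation,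
  replacement and induction are available for predicates definable with parameters.

  In a connected locally countable graph the endpoints of walks of length \<open>n\<close> from a fixed vertex
  form a countable set, by induction on \<open>n\<close> and \<open>UT\<close>; so there are countably many vertices, and a
  maximal independent set is built greedily along an enumeration. Conversely, for a family \<open>A\<close> take
  the graph with a hub and a clique for each \<open>a \<in> A\<close>, the clique consisting of the elements of \<open>a\<close>
  and the hub, and join all hubs to each other. A maximal independent set contains at most one hub,
  hence exactly one element of every clique whose hub it omits.
\<close>

section \<open>Completeness of the calculus\<close>

text \<open>The models may be nonstandard and the ambient logic has choice, so HOL predicates and
  functions must not be confused with sets of the model. A predicate may be used for separation or
  induction only if it is \<open>definable\<close>, a function for replacement or recursion only if
  it is a \<open>dterm\<close>. Set formers, function values and minima are therefore definite
  descriptions, and most proofs carry a definability obligation. In the first implication the danger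
  is that countable levels do not come with enumerations. The recursion builds the levels as sets
  only, and \<open>UT\<close> is applied to a family as a whole, so enumerations never have to be
  selected together. Levels and neighbourhoods may be finite, while \<open>UT\<close> speaks of
  denumerable sets. In the second implication the joined hubs provide connectedness, and local
  countability comes from the countability of \<open>A\<close> and of its members. The set
  \<open>a\<close> can mark its own hub because Foundation keeps it apart from the elements of
  \<open>a\<close>. The one hub that may be present costs an element of a single set, which can be
  named without choice.\<close>

abbreviation lift :: "(nat \<Rightarrow> nat) \<Rightarrow> nat \<Rightarrow> nat" where
  "lift f \<equiv> case_nat 0 (\<lambda>i. Suc (f i))"

section \<open>Renaming of variables\<close>

lemma ren_ren: "ren f (ren g p) = ren (f \<circ> g) p"
proof (induction p arbitrary: f g)
  case (Forall p)
  have "lift f \<circ> lift g = lift (f \<circ> g)" by (auto split: nat.split)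
  then show ?case by (simp add: Forall)
qed auto

lemma ren_cong: "(\<And>i. i \<in> fv p \<Longrightarrow> f i = g i) \<Longrightarrow> ren f p = ren g p"
proof (induction p arbitrary: f g)
  case (Forall p)
  have "ren (lift f) p = ren (lift g) p"
  proof (rule Forall.IH)
    show "lift f i = lift g i" if "i \<in> fv p" for i
      using that Forall.prems[of "i - 1"] by (cases i) auto
  qed
  then show ?case by simp
next
  case (Imp p q)
  have "ren f p = ren g p" "ren f q = ren g q"
    using Imp.prems by (auto intro!: Imp.IH)
  then show ?case by simp
qed auto

lemma ren_id: "ren (\<lambda>i. i) p = p"
proof (induction p)
  case (Forall p)
  have "lift (\<lambda>i. i) = (\<lambda>i. i)" by (auto split: nat.split)
  with Forall show ?case by simp
qed auto

lemma ren_inst: "ren f (inst t p) = inst (f t) (ren (lift f) p)"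
proof -
  have "f \<circ> case_nat t (\<lambda>i. i) = case_nat (f t) (\<lambda>i. i) \<circ> lift f"
    by (auto split: nat.split)
  then show ?thesis by (simp add: inst_def ren_ren)
qed

lemma inst_ren_lift: "inst t (ren (lift f) p) = ren (case_nat t f) p"
proof -
  have "case_nat t (\<lambda>i. i) \<circ> lift f = case_nat t f" by (auto split: nat.split)
  then show ?thesis by (simp add: inst_def ren_ren)
qed

lemma finite_fv: "finite (fv p)"
proof (induction p)
  case (Forall p)
  have "Suc ` fv (Forall p) \<subseteq> fv p" by auto
  then show ?case using Forall finite_subset finite_imageD by (metis inj_Suc)
qed auto

section \<open>Structural properties of derivability\<close>

lemma derivable_mono: "H \<turnstile> p \<Longrightarrow> H \<subseteq> H' \<Longrightarrow> H' \<turnstile> p"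
proof (induction arbitrary: H' rule: derivable.induct)
  case (AllI H p)
  then show ?case by (meson derivable.AllI image_mono)
qed (blast intro: derivable.intros)+

text \<open>The renaming need not be injective; halving of indices is used later. The rule
  \<open>AllI\<close> survives because \<open>lift f\<close> fixes the fresh index 0 and commutes
  with shifting the hypotheses.\<close>

lemma derivable_ren: "H \<turnstile> p \<Longrightarrow> ren f ` H \<turnstile> ren f p"
proof (induction arbitrary: f rule: derivable.induct)
  case (AllI H p)
  have "ren (lift f) ` ren Suc ` H = ren Suc ` ren f ` H"
    by (auto simp: image_image ren_ren comp_def)
  with AllI show ?case by (metis derivable.AllI ren.simps(5))
next
  case (AllE H p t)
  then show ?case by (simp add: ren_inst derivable.AllE)
next
  case (EqSubst H s t p)
  then show ?case unfolding ren_inst by (metis derivable.EqSubst ren.simps(2))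
next
  case (ImpE H p q)
  show ?case using ImpE.IH(1)[of f] ImpE.IH(2)[of f] by (simp add: derivable.ImpE)
next
  case (Classical p H)
  show ?case by (rule derivable.Classical) (use Classical.IH[of f] in simp)
qed (auto intro: derivable.Assm derivable.ImpI derivable.EqRefl)

text \<open>Derivations are finite trees. This is what keeps the union of a chain of consistent
  theories consistent.\<close>

lemma derivable_finite: "H \<turnstile> p \<Longrightarrow> \<exists>F. finite F \<and> F \<subseteq> H \<and> F \<turnstile> p"
proof (induction rule: derivable.induct)
  case (Assm p H)
  then show ?case by (intro exI[of _ "{p}"]) (auto intro: derivable.Assm)
next
  case (ImpI p H q)
  then obtain F where F: "finite F" "F \<subseteq> insert p H" "F \<turnstile> q" by blast
  then have "insert p (F - {p}) \<turnstile> q" by (auto elim: derivable_mono)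
  with F show ?case by (intro exI[of _ "F - {p}"]) (auto intro: derivable.ImpI)
next
  case (ImpE H p q)
  then obtain F G where "finite F" "F \<subseteq> H" "F \<turnstile> Imp p q" "finite G" "G \<subseteq> H" "G \<turnstile> p" by blast
  then show ?case
    by (intro exI[of _ "F \<union> G"])
      (meson Un_least Un_upper1 Un_upper2 derivable.ImpE derivable_mono finite_UnI)
next
  case (Classical p H)
  then obtain F where F: "finite F" "F \<subseteq> insert (Imp p Falsity) H" "F \<turnstile> Falsity" by blast
  then have "insert (Imp p Falsity) (F - {Imp p Falsity}) \<turnstile> Falsity" by (auto elim: derivable_mono)
  with F show ?case
    by (intro exI[of _ "F - {Imp p Falsity}"]) (auto intro: derivable.Classical)
next
  case (AllI H p)
  then obtain F where F: "finite F" "F \<subseteq> ren Suc ` H" "F \<turnstile> p" by blast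
  then obtain F' where "finite F'" "F' \<subseteq> H" "F = ren Suc ` F'"
    by (meson finite_subset_image)
  with F show ?case by (intro exI[of _ F']) (auto intro: derivable.AllI)
next
  case (EqSubst H s t p)
  then obtain F G where "finite F" "F \<subseteq> H" "F \<turnstile> Eq s t" "finite G" "G \<subseteq> H" "G \<turnstile> inst s p"
    by blast
  then show ?case
    by (intro exI[of _ "F \<union> G"])
      (meson Un_least Un_upper1 Un_upper2 derivable.EqSubst derivable_mono finite_UnI)
qed (auto intro: derivable.EqRefl derivable.AllE)

lemma derivable_Forall_fresh:
  assumes "H \<turnstile> inst t p" "\<And>q. q \<in> H \<Longrightarrow> t \<notin> fv q" "t \<notin> fv (Forall p)"
  shows "H \<turnstile> Forall p"
proof -
  \<comment> \<open>Moves \<open>t\<close> to index 0 and shifts all other variables. As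
    \<open>t\<close> is not free in the hypotheses, they are merely shifted, as \<open>AllI\<close>
    demands, while \<open>inst t p\<close> turns back into \<open>p\<close>.\<close>
  define f where "f i = (if i = t then 0 else Suc i)" for i
  have "ren f ` H = ren Suc ` H"
    by (rule image_cong) (use assms(2) in \<open>auto simp: f_def intro!: ren_cong\<close>)
  moreover have "ren f (inst t p) = ren (\<lambda>i. i) p"
    unfolding inst_def ren_ren
    by (rule ren_cong) (use assms(3) in \<open>auto simp: f_def split: nat.split\<close>)
  ultimately have "ren Suc ` H \<turnstile> p"
    using derivable_ren[OF assms(1), of f] by (simp add: ren_id)
  then show ?thesis by (rule derivable.AllI)
qed

section \<open>Henkin theories\<close>

abbreviation Neg :: "fm \<Rightarrow> fm" where "Neg p \<equiv> Imp p Falsity"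

definition extensible :: "fm set \<Rightarrow> bool" where
  "extensible H \<longleftrightarrow> \<not> H \<turnstile> Falsity \<and> infinite (- \<Union> (fv ` H))"

lemma extensible_insert:
  assumes "extensible H" "\<not> insert p H \<turnstile> Falsity"
  shows "extensible (insert p H)"
proof -
  have "- \<Union> (fv ` insert p H) = - \<Union> (fv ` H) - fv p" by auto
  then show ?thesis using assms finite_fv by (simp add: extensible_def Diff_infinite_finite)
qed

text \<open>If \<open>p\<close> cannot be added consistently, its negation can. When
  \<open>p\<close> is universal, a counterexample at a fresh variable is added too: were that
  inconsistent, \<open>derivable_Forall_fresh\<close> would prove \<open>p\<close>.\<close>

lemma Henkin_step:
  assumes H: "extensible H"
  shows "\<exists>H'. extensible H' \<and> H \<subseteq> H' \<and> (p \<in> H' \<or>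
    Neg p \<in> H' \<and> (\<forall>q. p = Forall q \<longrightarrow> (\<exists>t. Neg (inst t q) \<in> H')))"
proof (cases "insert p H \<turnstile> Falsity")
  case False
  then show ?thesis using extensible_insert[OF H] by blast
next
  case True
  have cons: "\<not> insert (Neg p) H \<turnstile> Falsity"
  proof
    assume "insert (Neg p) H \<turnstile> Falsity"
    then have "H \<turnstile> p" by (rule derivable.Classical)
    moreover have "H \<turnstile> Neg p" using True by (rule derivable.ImpI)
    ultimately show False using H derivable.ImpE unfolding extensible_def by blast
  qed
  define K where "K = insert (Neg p) H"
  have K: "extensible K" using extensible_insert[OF H cons] by (simp add: K_def)
  show ?thesis
  proof (cases "\<exists>q. p = Forall q")
    case False
    then show ?thesis using K by (auto simp: K_def)
  next
    case True
    then obtain q where q: "p = Forall q" by blast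
    obtain t where t: "t \<notin> \<Union> (fv ` K)"
      using K unfolding extensible_def by (metis ComplD finite.emptyI ex_in_conv)
    have "\<not> insert (Neg (inst t q)) K \<turnstile> Falsity"
    proof
      assume "insert (Neg (inst t q)) K \<turnstile> Falsity"
      then have "K \<turnstile> inst t q" by (rule derivable.Classical)
      moreover have "t \<notin> fv (Forall q)" using t by (auto simp: K_def q)
      ultimately have "K \<turnstile> p" using derivable_Forall_fresh t unfolding q by blast
      moreover have "K \<turnstile> Neg p" by (simp add: K_def derivable.Assm)
      ultimately show False using K derivable.ImpE unfolding extensible_def by blast
    qed
    from extensible_insert[OF K this] show ?thesis
      by (intro exI[of _ "insert (Neg (inst t q)) K"]) (auto simp: K_def q)
  qed
qed

instance fm :: countable by countable_datatype

text \<open>Stage \<open>n\<close> settles the \<open>n\<close>-th formula, and a derivation of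
  \<open>Falsity\<close> from the limit would already exist at some stage. Choice is harmless here,
  since the argument is about ZF and not inside it.\<close>

lemma Henkin_extension:
  assumes "extensible H"
  obtains T where "H \<subseteq> T" "\<not> T \<turnstile> Falsity" "\<And>p. p \<in> T \<or> Neg p \<in> T"
    "\<And>q. Forall q \<in> T \<or> (\<exists>t. Neg (inst t q) \<in> T)"
proof -
  let ?Q = "\<lambda>n H H'. H \<subseteq> H' \<and> (from_nat n \<in> H' \<or>
    Neg (from_nat n) \<in> H' \<and> (\<forall>q. from_nat n = Forall q \<longrightarrow> (\<exists>t. Neg (inst t q) \<in> H')))"
  \<comment> \<open>The clause for \<open>n = 0\<close> fixes the start of the chain.\<close>
  have "\<exists>h. \<forall>n. (extensible (h n) \<and> (n = 0 \<longrightarrow> h n = H)) \<and> ?Q n (h n) (h (Suc n))"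
    by (rule dependent_nat_choice) (use assms Henkin_step in auto)
  then obtain h where h: "\<And>n. extensible (h n)" "h 0 = H" "\<And>n. ?Q n (h n) (h (Suc n))" by metis
  have mono: "h m \<subseteq> h n" if "m \<le> n" for m n
    using lift_Suc_mono_le[of h, OF _ that] h(3) by blast
  define T where "T = (\<Union>n. h n)"
  have fin: "\<exists>n. F \<subseteq> h n" if "finite F" "F \<subseteq> T" for F
    using that
  proof (induction F)
    case (insert p F)
    then obtain m n where "F \<subseteq> h m" "p \<in> h n" by (auto simp: T_def)
    then have "insert p F \<subseteq> h (max m n)" using mono[of m "max m n"] mono[of n "max m n"] by auto
    then show ?case by blast
  qed auto
  have T: "h n \<subseteq> T" for n by (auto simp: T_def)
  show thesis
  proof
    show "H \<subseteq> T" using T[of 0] h(2) by simp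
    show "\<not> T \<turnstile> Falsity"
    proof
      assume "T \<turnstile> Falsity"
      then obtain n F where "F \<subseteq> h n" "F \<turnstile> Falsity" using derivable_finite fin by meson
      then have "h n \<turnstile> Falsity" using derivable_mono by blast
      with h(1) show False by (simp add: extensible_def)
    qed
    fix p
    show "p \<in> T \<or> Neg p \<in> T"
      using h(3)[of "to_nat p"] T[of "Suc (to_nat p)"] by auto
    show "Forall p \<in> T \<or> (\<exists>t. Neg (inst t p) \<in> T)"
      using h(3)[of "to_nat (Forall p)"] T[of "Suc (to_nat (Forall p))"] by auto
  qed
qed

text \<open>The universe is a set \<open>D\<close> and not a whole type, because the Henkin model
  lives on a set of representatives of variables.\<close>

fun sat :: "'a set \<Rightarrow> ('a \<Rightarrow> 'a \<Rightarrow> bool) \<Rightarrow> (nat \<Rightarrow> 'a) \<Rightarrow> fm \<Rightarrow> bool" where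
  "sat D R e (Mem i j) \<longleftrightarrow> R (e i) (e j)"
| "sat D R e (Eq i j) \<longleftrightarrow> e i = e j"
| "sat D R e Falsity \<longleftrightarrow> False"
| "sat D R e (Imp p q) \<longleftrightarrow> (sat D R e p \<longrightarrow> sat D R e q)"
| "sat D R e (Forall p) \<longleftrightarrow> (\<forall>x\<in>D. sat D R (case_nat x e) p)"

lemma sat_ren: "sat D R e (ren f p) \<longleftrightarrow> sat D R (e \<circ> f) p"
proof (induction p arbitrary: e f)
  case (Forall p)
  have "case_nat x e \<circ> lift f = case_nat x (e \<circ> f)" for x by (auto split: nat.split)
  then show ?case by (simp add: Forall del: comp_apply)
qed auto

text \<open>The equality of a Henkin theory is interpreted by true equality of least representatives.\<close>

lemma Henkin_model:
  assumes cons: "\<not> T \<turnstile> Falsity" and compl: "\<And>p. p \<in> T \<or> Neg p \<in> T"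
    and wit: "\<And>q. Forall q \<in> T \<or> (\<exists>t. Neg (inst t q) \<in> T)"
  obtains D R and e :: "nat \<Rightarrow> nat" where "range e \<subseteq> D" "\<And>p. sat D R e p \<longleftrightarrow> p \<in> T"
proof -
  have ded: "p \<in> T" if "T \<turnstile> p" for p
    using that compl[of p] cons derivable.ImpE derivable.Assm by blast
  have no: "p \<in> T \<Longrightarrow> Neg p \<in> T \<Longrightarrow> False" for p
    using cons derivable.ImpE derivable.Assm by blast
  have imp: "Imp p q \<in> T \<longleftrightarrow> (p \<in> T \<longrightarrow> q \<in> T)" for p q
  proof (intro iffI impI)
    assume "Imp p q \<in> T" "p \<in> T"
    then show "q \<in> T" using ded derivable.ImpE derivable.Assm by blast
  next
    assume pq: "p \<in> T \<longrightarrow> q \<in> T"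
    show "Imp p q \<in> T"
    proof (cases "p \<in> T")
      case True
      then show ?thesis using pq ded derivable.ImpI derivable.Assm by blast
    next
      case False
      then have "Neg p \<in> T" using compl by blast
      then have "insert p T \<turnstile> Falsity" using derivable.ImpE derivable.Assm by (metis insertCI)
      then have "insert p T \<turnstile> q" using derivable.Classical derivable_mono by (metis subset_insertI)
      then show ?thesis using ded derivable.ImpI by blast
    qed
  qed
  have all: "Forall q \<in> T \<longleftrightarrow> (\<forall>t. inst t q \<in> T)" for q
    using wit[of q] no ded derivable.AllE derivable.Assm by meson
  have subst: "inst s p \<in> T \<Longrightarrow> inst t p \<in> T" if "Eq s t \<in> T" for s t p
    using that ded derivable.EqSubst derivable.Assm by meson
  have refl: "Eq t t \<in> T" for t using ded derivable.EqRefl by blast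
  \<comment> \<open>Substitution is applied to the formula \<open>x = s\<close> with
    \<open>x\<close> at index 0; \<open>inst\<close> lowers the index \<open>Suc s\<close> to
    \<open>s\<close>.\<close>
  have sym: "Eq t s \<in> T" if "Eq s t \<in> T" for s t
    using subst[OF that, of "Eq 0 (Suc s)"] refl by (simp add: inst_def)
  have trans: "Eq s u \<in> T" if "Eq s t \<in> T" "Eq t u \<in> T" for s t u
    using subst[OF that(2), of "Eq (Suc s) 0"] that(1) by (simp add: inst_def)
  have memc: "Mem s' t' \<in> T" if "Mem s t \<in> T" "Eq s s' \<in> T" "Eq t t' \<in> T" for s t s' t'
    using subst[OF that(2), of "Mem 0 (Suc t)"] subst[OF that(3), of "Mem (Suc s') 0"] that(1)
    by (simp add: inst_def)
  define r where "r t = (LEAST s. Eq s t \<in> T)" for t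
  have r: "Eq (r t) t \<in> T" for t unfolding r_def by (rule LeastI) (rule refl)
  have r': "Eq t (r t) \<in> T" for t by (rule sym) (rule r)
  have r_eq: "r s = r t \<longleftrightarrow> Eq s t \<in> T" for s t
  proof
    assume "r s = r t"
    then show "Eq s t \<in> T" using r[of t] r'[of s] trans by metis
  next
    assume "Eq s t \<in> T"
    then have "Eq u s \<in> T \<longleftrightarrow> Eq u t \<in> T" for u using trans sym by blast
    then show "r s = r t" by (simp add: r_def)
  qed
  \<comment> \<open>Stated for every renaming \<open>f\<close>, because below a quantifier the
    environment is the one belonging to \<open>case_nat t f\<close>.\<close>
  have "sat (range r) (\<lambda>s t. Mem s t \<in> T) (r \<circ> f) p \<longleftrightarrow> ren f p \<in> T" for f p
  proof (induction p arbitrary: f)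
    case (Mem i j)
    show ?case
      using memc[OF _ r r, of "f i" "f j"] memc[OF _ r' r', of "f i" "f j"] by fastforce
  next
    case (Eq i j)
    show ?case by (simp add: r_eq)
  next
    case Falsity
    show ?case using cons derivable.Assm by auto
  next
    case (Imp p q)
    then show ?case by (simp add: imp)
  next
    case (Forall p)
    have "case_nat (r t) (r \<circ> f) = r \<circ> case_nat t f" for t by (auto split: nat.split)
    with Forall show ?case by (simp add: all inst_ren_lift del: comp_apply)
  qed
  from this[of "\<lambda>i. i"] have "sat (range r) (\<lambda>s t. Mem s t \<in> T) r p \<longleftrightarrow> p \<in> T" for p
    by (simp add: ren_id comp_def)
  then show thesis
    by (intro that[where D = "range r" and e = r and R = "\<lambda>s t. Mem s t \<in> T"]) simp_all
qed

text \<open>Doubling the indices of the hypotheses leaves infinitely many variables for the witnesses.\<close>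

theorem completeness:
  assumes "\<not> H \<turnstile> p"
  obtains D R and e :: "nat \<Rightarrow> nat"
  where "range e \<subseteq> D" "\<And>q. q \<in> H \<Longrightarrow> sat D R e q" "\<not> sat D R e p"
proof -
  let ?H = "ren (\<lambda>i. 2 * i) ` insert (Neg p) H"
  have "\<not> ?H \<turnstile> Falsity"
  proof
    assume "?H \<turnstile> Falsity"
    \<comment> \<open>Halving is a left inverse of doubling, so an inconsistency is carried back to
      the original hypotheses.\<close>
    then have "ren (\<lambda>i. i div 2) ` ?H \<turnstile> Falsity" using derivable_ren by (metis ren.simps(3))
    moreover have "ren (\<lambda>i. i div 2) ` ?H = insert (Neg p) H"
      unfolding image_image ren_ren by (simp add: comp_def ren_id)
    ultimately show False using assms derivable.Classical by metis
  qed
  moreover have "infinite (- \<Union> (fv ` ?H))"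
  proof -
    have fv_ren: "fv (ren f q) = f ` fv q" for f q
    proof (induction q arbitrary: f)
      case (Forall q)
      have "Suc i \<in> lift f ` fv q \<longleftrightarrow> i \<in> f ` {j. Suc j \<in> fv q}" for i
      proof
        assume "Suc i \<in> lift f ` fv q"
        then obtain j where "j \<in> fv q" "Suc i = lift f j" by blast
        then show "i \<in> f ` {j. Suc j \<in> fv q}" by (cases j) auto
      next
        assume "i \<in> f ` {j. Suc j \<in> fv q}"
        then obtain j where "Suc j \<in> fv q" "Suc i = lift f (Suc j)" by auto
        then show "Suc i \<in> lift f ` fv q" by (rule rev_image_eqI)
      qed
      then show ?case by (simp add: Forall set_eq_iff)
    qed auto
    have "range (\<lambda>i. Suc (2 * i)) \<subseteq> - \<Union> (fv ` ?H)"
      by (auto simp: fv_ren) presburger+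
    moreover have "infinite (range (\<lambda>i::nat. Suc (2 * i)))"
      by (simp add: finite_image_iff inj_def)
    ultimately show ?thesis using finite_subset by blast
  qed
  ultimately have "extensible ?H" by (simp add: extensible_def)
  then obtain T where T: "?H \<subseteq> T" "\<not> T \<turnstile> Falsity" "\<And>p. p \<in> T \<or> Neg p \<in> T"
    "\<And>q. Forall q \<in> T \<or> (\<exists>t. Neg (inst t q) \<in> T)"
    by (rule Henkin_extension) blast
  obtain D R and e :: "nat \<Rightarrow> nat" where e: "range e \<subseteq> D" "\<And>q. sat D R e q \<longleftrightarrow> q \<in> T"
    by (rule Henkin_model[OF T(2-4)]) blast
  have *: "sat D R (e \<circ> (\<lambda>i. 2 * i)) q" if "q \<in> insert (Neg p) H" for q
    using that T(1) e(2)[of "ren (\<lambda>i. 2 * i) q"] unfolding sat_ren by blast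
  show thesis
  proof (rule that[where D = D and R = R and e = "e \<circ> (\<lambda>i. 2 * i)"])
    show "range (e \<circ> (\<lambda>i. 2 * i)) \<subseteq> D" using e(1) by auto
    show "\<not> sat D R (e \<circ> (\<lambda>i. 2 * i)) p" using *[of "Neg p"] by simp
  qed (rule *, simp)
qed

section \<open>Models of ZF and definability\<close>

lemma sat_cong: "(\<And>i. i \<in> fv p \<Longrightarrow> e i = e' i) \<Longrightarrow> sat D R e p \<longleftrightarrow> sat D R e' p"
proof (induction p arbitrary: e e')
  case (Forall p)
  have "sat D R (case_nat x e) p \<longleftrightarrow> sat D R (case_nat x e') p" for x
  proof (rule Forall.IH)
    show "case_nat x e i = case_nat x e' i" if "i \<in> fv p" for i
      using that Forall.prems[of "i - 1"] by (cases i) auto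
  qed
  then show ?case by simp
next
  case (Imp p q)
  have "sat D R e p \<longleftrightarrow> sat D R e' p" "sat D R e q \<longleftrightarrow> sat D R e' q"
    using Imp.prems by (auto intro!: Imp.IH)
  then show ?case by simp
qed auto

text \<open>\<open>lv e d x\<close> is the value of the variable with level \<open>x\<close> below \<open>d\<close> quantifiers.\<close>

definition lv :: "(nat \<Rightarrow> 'a) \<Rightarrow> nat \<Rightarrow> nat \<Rightarrow> 'a" where
  "lv e d x = e (d - 1 - x)"

lemma lv_new: "lv (case_nat a e) (Suc d) d = a"
  by (simp add: lv_def)

lemma lv_old: "x < d \<Longrightarrow> lv (case_nat a e) (Suc d) x = lv e d x"
  by (simp add: lv_def Suc_diff_Suc[symmetric] del: Suc_diff_Suc)

lemma sat_form:
  "sat D R e ((x \<^bold>\<in> y) d) \<longleftrightarrow> R (lv e d x) (lv e d y)"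
  "sat D R e ((x \<^bold>= y) d) \<longleftrightarrow> lv e d x = lv e d y"
  "sat D R e ((P \<^bold>\<longrightarrow> Q) d) \<longleftrightarrow> (sat D R e (P d) \<longrightarrow> sat D R e (Q d))"
  "sat D R e ((\<^bold>\<not> P) d) \<longleftrightarrow> \<not> sat D R e (P d)"
  "sat D R e ((P \<^bold>\<or> Q) d) \<longleftrightarrow> sat D R e (P d) \<or> sat D R e (Q d)"
  "sat D R e ((P \<^bold>\<and> Q) d) \<longleftrightarrow> sat D R e (P d) \<and> sat D R e (Q d)"
  "sat D R e ((P \<^bold>\<longleftrightarrow> Q) d) \<longleftrightarrow> (sat D R e (P d) \<longleftrightarrow> sat D R e (Q d))"
  "sat D R e ((f_all F) d) \<longleftrightarrow> (\<forall>a\<in>D. sat D R (case_nat a e) (F d (Suc d)))"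
  "sat D R e ((f_ex F) d) \<longleftrightarrow> (\<exists>a\<in>D. sat D R (case_nat a e) (F d (Suc d)))"
  "sat D R e (f_app p xs d) \<longleftrightarrow> sat D R (\<lambda>i. lv e d (xs ! i)) p"
  by (auto simp: f_mem_def f_eq_def f_imp_def f_not_def f_or_def f_and_def f_iff_def f_all_def
      f_ex_def f_app_def lv_def sat_ren comp_def)

lemmas sat_simps = sat_form lv_new lv_old less_SucI

text \<open>Gives all parameters of an axiom schema their values at once; the environment that came
  with the axiom stays behind them.\<close>

lemma sat_Forall_funpow:
  "sat UNIV R e ((Forall ^^ n) p) \<Longrightarrow> sat UNIV R (\<lambda>i. if i < n then g i else e (i - n)) p"
proof (induction n arbitrary: e)
  case (Suc n)
  then have "sat UNIV R (case_nat (g n) e) ((Forall ^^ n) p)" by simp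
  from Suc.IH[OF this] show ?case
    by (rule iffD1[OF sat_cong, rotated]) (auto simp: not_less less_Suc_eq diff_Suc split: nat.split)
qed simp

lemma sat_bij:
  assumes "bij_betw h UNIV D"
  shows "sat UNIV (\<lambda>x y. R (h x) (h y)) e p \<longleftrightarrow> sat D R (h \<circ> e) p"
proof (induction p arbitrary: e)
  case (Eq i j)
  then show ?case using bij_betw_imp_inj_on[OF assms] by (auto dest: injD)
next
  case (Forall p)
  have "case_nat (h x) (h \<circ> e) = h \<circ> case_nat x e" for x by (auto split: nat.split)
  moreover have "D = range h" using assms by (simp add: bij_betw_def)
  ultimately show ?case by (simp add: Forall del: comp_apply)
qed auto

text \<open>Pairing and union enlarge \<open>u\<close> to the union of \<open>u\<close> and
  \<open>{x}\<close>, so finitely many elements always lie in a common one. In a finite universe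
  some element would thus contain everything, itself included, against Foundation. Infinity of
  \<open>D\<close> allows the universe to be replaced by all natural numbers.\<close>

lemma infinite_model:
  assumes "D \<noteq> {}" and ZF: "\<And>p. p \<in> ZF \<Longrightarrow> sat D R e p"
  shows "infinite D"
proof
  have pairing: "\<forall>x\<in>D. \<forall>y\<in>D. \<exists>p\<in>D. \<forall>z\<in>D. R z p \<longleftrightarrow> z = x \<or> z = y"
    using ZF[of Pairing] by (simp add: ZF_def Pairing_def is_upair_def sat_simps)
  have union: "\<forall>a\<in>D. \<exists>u\<in>D. \<forall>z\<in>D. R z u \<longleftrightarrow> (\<exists>x\<in>D. R x a \<and> R z x)"
    using ZF[of Union_axiom] by (simp add: ZF_def Union_axiom_def is_Union_def sat_simps)
  have "\<forall>x\<in>D. \<not> (\<forall>y\<in>D. \<not> R y x) \<longrightarrow> (\<exists>y\<in>D. R y x \<and> \<not> (\<exists>z\<in>D. R z x \<and> R z y))"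
    using ZF[of Foundation] by (simp add: ZF_def Foundation_def is_empty_def sat_simps)
  then have foundation: "\<exists>y\<in>D. R y x \<and> \<not> (\<exists>z\<in>D. R z x \<and> R z y)"
    if "x \<in> D" "y \<in> D" "R y x" for x y
    using that by meson
  have irrefl: "\<not> R x x" if x: "x \<in> D" for x
  proof -
    obtain p where p: "p \<in> D" "\<forall>z\<in>D. R z p \<longleftrightarrow> z = x"
      using bspec[OF bspec[OF pairing x] x] by auto
    have "R x p" using bspec[OF p(2) x] by simp
    from foundation[OF p(1) x this] show ?thesis
    proof (elim bexE conjE)
      fix y assume y: "y \<in> D" "R y p" "\<not> (\<exists>z\<in>D. R z p \<and> R z y)"
      have "y = x" using bspec[OF p(2) y(1)] y(2) by simp
      with y(3) x \<open>R x p\<close> show "\<not> R x x" by blast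
    qed
  qed
  assume "finite D"
  have "\<exists>u\<in>D. \<forall>x\<in>F. R x u" if "finite F" "F \<subseteq> D" for F
    using that
  proof (induction F)
    case empty
    then show ?case using assms(1) by auto
  next
    case (insert x F)
    then obtain u where u: "u \<in> D" "\<forall>x\<in>F. R x u" by auto
    have xD: "x \<in> D" using insert by simp
    obtain p where p: "p \<in> D" "\<forall>z\<in>D. R z p \<longleftrightarrow> z = x"
      using bspec[OF bspec[OF pairing xD] xD] by auto
    obtain q where q: "q \<in> D" "\<forall>z\<in>D. R z q \<longleftrightarrow> z = u \<or> z = p"
      using bspec[OF bspec[OF pairing u(1)] p(1)] by auto
    obtain w where w: "w \<in> D" "\<forall>z\<in>D. R z w \<longleftrightarrow> (\<exists>x\<in>D. R x q \<and> R z x)"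
      using bspec[OF union q(1)] by auto
    show ?case
    proof (intro bexI[OF _ w(1)] ballI)
      fix y assume "y \<in> insert x F"
      then have y: "y \<in> D" "y = x \<or> y \<in> F" using insert.prems by auto
      have "R u q" "R p q" using q(2) u(1) p(1) by simp_all
      moreover have "R y u \<or> R y p" using y u(2) bspec[OF p(2) y(1)] by auto
      ultimately show "R y w" using bspec[OF w(2) y(1)] u(1) p(1) by blast
    qed
  qed
  from this[OF \<open>finite D\<close> order_refl] show False using irrefl by blast
qed

locale zf_model =
  fixes mem :: "'a \<Rightarrow> 'a \<Rightarrow> bool" (infix "\<epsilon>" 50)
  assumes sat_ZF: "\<exists>e. \<forall>p\<in>ZF. sat UNIV mem e p"

text \<open>Completeness provides a countermodel on an infinite set of natural numbers. Its
  enumeration spreads the model over the whole type, so that quantifiers of the model become HOL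
  quantifiers.\<close>

theorem ZF_derivableI:
  assumes "\<And>(R :: nat \<Rightarrow> nat \<Rightarrow> bool) e. zf_model R \<Longrightarrow> sat UNIV R e p"
  shows "ZF \<turnstile> p"
proof (rule ccontr)
  assume "\<not> ZF \<turnstile> p"
  then obtain D R and e :: "nat \<Rightarrow> nat" where
    e: "range e \<subseteq> D" and ZF: "\<And>q. q \<in> ZF \<Longrightarrow> sat D R e q" and p: "\<not> sat D R e p"
    by (rule completeness) blast
  define h where "h = enumerate D"
  have "infinite D" using infinite_model[of D R e] e ZF by blast
  then have h: "bij_betw h UNIV D" unfolding h_def by (rule bij_enumerate)
  have e_eq: "e = h \<circ> (inv h \<circ> e)"
  proof
    fix i
    have "e i \<in> range h" using e bij_betw_imp_surj_on[OF h] by auto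
    then show "e i = (h \<circ> (inv h \<circ> e)) i" by (simp add: f_inv_into_f)
  qed
  let ?R = "\<lambda>x y. R (h x) (h y)"
  have "sat UNIV ?R (inv h \<circ> e) q \<longleftrightarrow> sat D R e q" for q
    using sat_bij[OF h, of R "inv h \<circ> e" q] e_eq by simp
  then have "zf_model ?R" and "\<not> sat UNIV ?R (inv h \<circ> e) p"
    using ZF p by (auto simp: zf_model_def)
  then show False using assms by blast
qed

context zf_model
begin

text \<open>
  The even indices of the formula are the arguments, the odd ones the parameters.
\<close>

definition definable :: "((nat \<Rightarrow> 'a) \<Rightarrow> bool) \<Rightarrow> bool" where
  "definable Q \<longleftrightarrow> (\<exists>p c. \<forall>e. Q e \<longleftrightarrow> sat UNIV mem (\<lambda>i. if even i then e (i div 2) else c (i div 2)) p)"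

text \<open>A function of the environment is definable if its graph, with the value in front, is.\<close>

definition dterm :: "((nat \<Rightarrow> 'a) \<Rightarrow> 'a) \<Rightarrow> bool" where
  "dterm t \<longleftrightarrow> definable (\<lambda>e. e 0 = t (\<lambda>i. e (Suc i)))"

named_theorems definable

lemma definable_ren: "definable Q \<Longrightarrow> definable (\<lambda>e. Q (\<lambda>i. e (f i)))"
proof -
  assume "definable Q"
  then obtain p c where
    Q: "\<And>e. Q e \<longleftrightarrow> sat UNIV mem (\<lambda>i. if even i then e (i div 2) else c (i div 2)) p"
    unfolding definable_def by blast
  have "(\<lambda>i. if even i then e (i div 2) else c (i div 2)) \<circ> (\<lambda>i. if even i then 2 * f (i div 2) else i)
    = (\<lambda>i. if even i then e (f (i div 2)) else c (i div 2))" for e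
    by auto
  then show ?thesis unfolding definable_def Q
    by (intro exI[of _ "ren (\<lambda>i. if even i then 2 * f (i div 2) else i) p"] exI[of _ c])
      (simp add: sat_ren)
qed

text \<open>The two formulas bring different parameter sequences. \<open>c\<close> interleaves them,
  and \<open>f 0\<close> and \<open>f 1\<close> redirect the odd indices to the respective
  half.\<close>

lemma definable_two:
  assumes "definable P" "definable Q"
  obtains p q c where
    "\<And>e. P e \<longleftrightarrow> sat UNIV mem (\<lambda>i. if even i then e (i div 2) else c (i div 2)) p"
    "\<And>e. Q e \<longleftrightarrow> sat UNIV mem (\<lambda>i. if even i then e (i div 2) else c (i div 2)) q"
proof -
  obtain p a where
    P: "\<And>e. P e \<longleftrightarrow> sat UNIV mem (\<lambda>i. if even i then e (i div 2) else a (i div 2)) p"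
    using assms(1) unfolding definable_def by blast
  obtain q b where
    Q: "\<And>e. Q e \<longleftrightarrow> sat UNIV mem (\<lambda>i. if even i then e (i div 2) else b (i div 2)) q"
    using assms(2) unfolding definable_def by blast
  define c where "c i = (if even i then a (i div 2) else b (i div 2))" for i
  define f where "f k i = (if even i then i else Suc (2 * (2 * (i div 2) + k)))" for k i :: nat
  have "(\<lambda>i. if even i then e (i div 2) else c (i div 2)) \<circ> f 0
    = (\<lambda>i. if even i then e (i div 2) else a (i div 2))"
    and "(\<lambda>i. if even i then e (i div 2) else c (i div 2)) \<circ> f 1
    = (\<lambda>i. if even i then e (i div 2) else b (i div 2))" for e
    by (auto simp: fun_eq_iff f_def c_def elim!: oddE)
  then show thesis
    by (intro that[where p = "ren (f 0) p" and q = "ren (f 1) q" and c = c])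
      (simp_all add: P Q sat_ren)
qed

lemma definable_imp [definable]: "definable P \<Longrightarrow> definable Q \<Longrightarrow> definable (\<lambda>e. P e \<longrightarrow> Q e)"
proof -
  assume "definable P" "definable Q"
  then obtain p q c where
    "\<And>e. P e \<longleftrightarrow> sat UNIV mem (\<lambda>i. if even i then e (i div 2) else c (i div 2)) p"
    "\<And>e. Q e \<longleftrightarrow> sat UNIV mem (\<lambda>i. if even i then e (i div 2) else c (i div 2)) q"
    by (rule definable_two) blast
  then show ?thesis unfolding definable_def by (intro exI[of _ "Imp p q"] exI[of _ c]) simp
qed

lemma definable_const [definable]: "definable (\<lambda>e. b)"
proof (cases b)
  case True
  then show ?thesis unfolding definable_def by (intro exI[of _ "Imp Falsity Falsity"]) simp
next
  case False
  then show ?thesis unfolding definable_def by (intro exI[of _ Falsity]) simp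
qed

lemma definable_not [definable]: "definable P \<Longrightarrow> definable (\<lambda>e. \<not> P e)"
  using definable_imp[OF _ definable_const[of False]] by simp

lemma definable_or [definable]: "definable P \<Longrightarrow> definable Q \<Longrightarrow> definable (\<lambda>e. P e \<or> Q e)"
  using definable_imp[OF definable_not] by (simp add: disj_imp)

lemma definable_and [definable]: "definable P \<Longrightarrow> definable Q \<Longrightarrow> definable (\<lambda>e. P e \<and> Q e)"
  using definable_not[OF definable_imp[OF _ definable_not]] by simp

lemma definable_iff [definable]: "definable P \<Longrightarrow> definable Q \<Longrightarrow> definable (\<lambda>e. P e \<longleftrightarrow> Q e)"
  using definable_and[OF definable_imp[of P Q] definable_imp[of Q P]]
    by (simp add: iff_conv_conj_imp)

lemma definable_all [definable]:
  assumes "definable (\<lambda>e. P (e 0) (\<lambda>i. e (Suc i)))"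
  shows "definable (\<lambda>e. \<forall>x. P x e)"
proof -
  obtain p c where
    P: "\<And>e. P (e 0) (\<lambda>i. e (Suc i)) \<longleftrightarrow>
      sat UNIV mem (\<lambda>i. if even i then e (i div 2) else c (i div 2)) p"
    using assms unfolding definable_def by blast
  \<comment> \<open>Under \<open>Forall\<close> the bound variable is index 0 and all old indices
    move up by one, which swaps even and odd. \<open>f\<close> looks up every argument and parameter
    at its new place.\<close>
  define f where "f i = (if i = 0 then 0 else if even i then i - 1 else Suc i)" for i :: nat
  have "case_nat x (\<lambda>i. if even i then e (i div 2) else c (i div 2)) \<circ> f
    = (\<lambda>i. if even i then case_nat x e (i div 2) else c (i div 2))" for x e
  proof
    fix i
    show "(case_nat x (\<lambda>i. if even i then e (i div 2) else c (i div 2)) \<circ> f) i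
      = (if even i then case_nat x e (i div 2) else c (i div 2))"
    proof (cases "even i")
      case True
      then obtain k where "i = 2 * k" by (elim evenE)
      then show ?thesis by (cases k) (simp_all add: f_def)
    next
      case False
      then obtain k where "i = 2 * k + 1" by (elim oddE)
      then show ?thesis by (simp add: f_def)
    qed
  qed
  then have "(\<forall>x. P x e) \<longleftrightarrow>
      sat UNIV mem (\<lambda>i. if even i then e (i div 2) else c (i div 2)) (Forall (ren f p))" for e
    using P[of "case_nat _ e"] by (simp add: sat_ren)
  then show ?thesis unfolding definable_def by blast
qed

lemma definable_ex [definable]:
  "definable (\<lambda>e. P (e 0) (\<lambda>i. e (Suc i))) \<Longrightarrow> definable (\<lambda>e. \<exists>x. P x e)"
  using definable_not[OF definable_all[OF definable_not]] by simp

lemma definable_ex1 [definable]: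
  assumes "definable (\<lambda>e. P (e 0) (\<lambda>i. e (Suc i)))"
  shows "definable (\<lambda>e. \<exists>!x. P x e)"
proof -
  have eq: "definable (\<lambda>e. e 0 = e 1)"
    unfolding definable_def by (intro exI[of _ "Eq 0 2"]) simp
  have "definable (\<lambda>e. P (e 0) (\<lambda>i. e (Suc (Suc i))))"
    using definable_ren[OF assms, of "\<lambda>i. if i = 0 then 0 else Suc i"] by simp
  from this eq have "definable (\<lambda>e. \<exists>x. P x e \<and> (\<forall>y. P y e \<longrightarrow> y = x))"
    by (intro definable_ex definable_and assms definable_all definable_imp) simp_all
  then show ?thesis by (simp add: Ex1_def)
qed

lemma dterm_var [definable]: "dterm (\<lambda>e. e i)"
  unfolding dterm_def definable_def by (intro exI[of _ "Eq 0 (2 * Suc i)"]) simp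

lemma dterm_const [definable]: "dterm (\<lambda>e. c)"
  unfolding dterm_def definable_def by (intro exI[of _ "Eq 0 1"] exI[of _ "\<lambda>_. c"]) simp

lemma dterm_ren: "dterm t \<Longrightarrow> dterm (\<lambda>e. t (\<lambda>i. e (f i)))"
  using definable_ren[of "\<lambda>e. e 0 = t (\<lambda>i. e (Suc i))" "case_nat 0 (\<lambda>i. Suc (f i))"]
    by (simp add: dterm_def)

lemma definable_let:
  assumes "definable (\<lambda>e. P (e 0) (\<lambda>i. e (Suc i)))" "dterm t"
  shows "definable (\<lambda>e. P (t e) e)"
proof -
  have "definable (\<lambda>e. \<exists>x. x = t e \<and> P x e)"
    using assms unfolding dterm_def by (intro definable_ex definable_and)
  then show ?thesis by simp
qed

text \<open>This lemma and the next two reduce closure under arbitrary definable arguments to the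
  case where the arguments are the variables 0, 1, 2.\<close>

lemma definable_sub1: "definable (\<lambda>e. P (e 0)) \<Longrightarrow> dterm s \<Longrightarrow> definable (\<lambda>e. P (s e))"
  by (rule definable_let[where P = "\<lambda>x e. P x"])

lemma definable_sub2:
  assumes "definable (\<lambda>e. P (e 0) (e 1))" "dterm s" "dterm t"
  shows "definable (\<lambda>e. P (s e) (t e))"
proof (rule definable_let[where P = "\<lambda>x e. P x (t e)", OF _ assms(2)])
  have "definable (\<lambda>e. P (e (Suc 0)) (e 0))"
    using definable_ren[OF assms(1), of "\<lambda>i. 1 - i"] by simp
  then show "definable (\<lambda>e. P (e 0) (t (\<lambda>i. e (Suc i))))"
    by (rule definable_let[where P = "\<lambda>y e. P (e 0) y", OF _ dterm_ren[OF assms(3)]])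
qed

lemma definable_sub3:
  assumes "definable (\<lambda>e. P (e 0) (e 1) (e 2))" "dterm s" "dterm t" "dterm u"
  shows "definable (\<lambda>e. P (s e) (t e) (u e))"
proof (rule definable_let[where P = "\<lambda>x e. P x (t e) (u e)", OF _ assms(2)])
  have "definable (\<lambda>e. P (e 2) (e 1) (e 0))"
    using definable_ren[OF assms(1), of "\<lambda>i. 2 - i"] by (simp add: numeral_2_eq_2)
  then have "definable (\<lambda>e. P (e 1) (e 0) (u (\<lambda>i. e (Suc (Suc i)))))"
    by (intro definable_let[where P = "\<lambda>z e. P (e 1) (e 0) z", OF _ dterm_ren[OF assms(4)]])
      (simp add: numeral_2_eq_2)
  then show "definable (\<lambda>e. P (e 0) (t (\<lambda>i. e (Suc i))) (u (\<lambda>i. e (Suc i))))"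
    by (intro definable_let[where P = "\<lambda>y e. P (e 0) y (u (\<lambda>i. e (Suc i)))",
      OF _ dterm_ren[OF assms(3)]])
      simp
qed

lemma dterm_sub1:
  assumes "dterm (\<lambda>e. f (e 0))" "dterm s"
  shows "dterm (\<lambda>e. f (s e))"
proof -
  have "definable (\<lambda>e. e (Suc 0) = f (e 0))"
    using definable_ren[OF assms(1)[unfolded dterm_def], of "\<lambda>i. 1 - i"] by simp
  then show ?thesis
    unfolding dterm_def
      by (rule definable_let[where P = "\<lambda>x e. e 0 = f x", OF _ dterm_ren[OF assms(2)]])
qed

lemma definable_mem [definable]: "dterm s \<Longrightarrow> dterm t \<Longrightarrow> definable (\<lambda>e. s e \<epsilon> t e)"
  by (rule definable_sub2) (unfold definable_def, intro exI[of _ "Mem 0 2"], simp)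

lemma definable_eq [definable]: "dterm s \<Longrightarrow> dterm t \<Longrightarrow> definable (\<lambda>e. s e = t e)"
  by (rule definable_sub2) (unfold definable_def, intro exI[of _ "Eq 0 2"], simp)

text \<open>The default does not depend on \<open>P\<close>, so it can enter a formula as a
  parameter and descriptions have definable graphs even where they fail. With \<open>THE\<close>
  alone the value would be unspecified in that case.\<close>

definition iota :: "('a \<Rightarrow> bool) \<Rightarrow> 'a" where
  "iota P = (if \<exists>!x. P x then THE x. P x else (SOME x. True))"

lemma iota_eq: "P x \<Longrightarrow> (\<And>y. P y \<Longrightarrow> y = x) \<Longrightarrow> iota P = x"
  unfolding iota_def using theI'[of P] by metis

lemma iotaI: "\<exists>!x. P x \<Longrightarrow> P (iota P)"
  unfolding iota_def using theI'[of P] by simp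

lemma dterm_iota [definable]:
  assumes "definable (\<lambda>e. P (e 0) (\<lambda>i. e (Suc i)))"
  shows "dterm (\<lambda>e. iota (\<lambda>x. P x e))"
proof -
  have "(y = iota (\<lambda>x. P x e)) \<longleftrightarrow>
    (\<exists>!x. P x e) \<and> P y e \<or> \<not> (\<exists>!x. P x e) \<and> y = (SOME x. True)" for y e
    unfolding iota_def using theI'[of "\<lambda>x. P x e"] by auto
  moreover have "definable (\<lambda>e. P (e 0) (\<lambda>i. e (Suc (Suc i))))"
    using definable_ren[OF assms, of "\<lambda>i. if i = 0 then 0 else Suc i"] by simp
  ultimately show ?thesis
    unfolding dterm_def by (simp only:) (intro definable assms)
qed

lemma dterm_If [definable]:
  assumes "definable P" "dterm s" "dterm t"
  shows "dterm (\<lambda>e. if P e then s e else t e)"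
proof -
  have "(y = (if b then x else z)) \<longleftrightarrow> b \<and> y = x \<or> \<not> b \<and> y = z" for y x z :: 'a and b by simp
  then show ?thesis
    unfolding dterm_def
      by (simp only:) (intro definable definable_ren[OF assms(1)]
        dterm_ren[OF assms(2)] dterm_ren[OF assms(3)])
qed

section \<open>The axioms of ZF as facts about the model\<close>

lemma ZF_sat: "p \<in> ZF \<Longrightarrow> \<exists>e. sat UNIV mem e p"
  using sat_ZF by blast

lemma lv_parameter:
  "j < n \<Longrightarrow> lv (\<lambda>i. if i < n then q (n - 1 - i) else e (i - n)) n j = q j"
  by (simp add: lv_def)

text \<open>The parameters of a definable predicate form an infinite sequence, but its formula has
  finitely many free variables, so an initial segment of length \<open>n\<close> can be passed to an
  instance of the schema.\<close>

lemma separation: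
  assumes "definable (\<lambda>e. P (e 0))"
  shows "\<exists>b. \<forall>x. x \<epsilon> b \<longleftrightarrow> x \<epsilon> a \<and> P x"
proof -
  obtain p c where
    P: "\<And>e. P (e 0) \<longleftrightarrow> sat UNIV mem (\<lambda>i. if even i then e (i div 2) else c (i div 2)) p"
    using assms unfolding definable_def by blast
  \<comment> \<open>Index 0 is for \<open>x\<close> and index 1 for the set \<open>a\<close>; the
    parameter at an odd index \<open>i\<close> moves to \<open>i + 2\<close>. All arguments go to 0,
    since \<open>P\<close> is evaluated in the constant environment \<open>x\<close>.\<close>
  define p' where "p' = ren (\<lambda>i. if even i then 0 else i + 2) p"
  define q where "q i = c (i div 2)" for i
  have P': "P x \<longleftrightarrow> sat UNIV mem (case_nat x (case_nat a q)) p'" for x a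
    using P[of "\<lambda>_. x"] unfolding p'_def sat_ren
    by (auto simp: q_def fun_eq_iff elim!: iffD1[OF sat_cong, rotated] oddE)
  obtain n where "fv p' \<subseteq> {..<n}" using finite_fv finite_nat_iff_bounded by blast
  then have n: "fv p' \<subseteq> {..<n + 2}" by auto
  have "Separation n p' \<in> ZF" using n by (auto simp: ZF_def)
  then obtain e where "sat UNIV mem e (Separation n p')" using ZF_sat by blast
  \<comment> \<open>Level \<open>j\<close> below \<open>n\<close> quantifiers is the index
    \<open>n - 1 - j\<close>, hence the reversed order of the values.\<close>
  note * = sat_Forall_funpow[OF this[unfolded Separation_def], of "\<lambda>i. q (n - 1 - i)"]
  define E where "E = (\<lambda>i. if i < n then q (n - 1 - i) else e (i - n))"
  let ?E = "\<lambda>a b x. case_nat x (case_nat b (case_nat a E))"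
  have "\<forall>a. \<exists>b. \<forall>x. x \<epsilon> b \<longleftrightarrow> x \<epsilon> a \<and>
      sat UNIV mem (\<lambda>i. lv (?E a b x) (Suc (Suc (Suc n))) (([Suc (Suc n), n] @ [0..<n]) ! i)) p'"
    using *[folded E_def] by (simp add: sat_simps)
  moreover have "sat UNIV mem (\<lambda>i. lv (?E a b x) (Suc (Suc (Suc n))) (([Suc (Suc n), n] @ [0..<n]) ! i)) p'
      \<longleftrightarrow> P x" for a b x
    unfolding P'[of x a]
  proof (rule sat_cong)
    fix i assume "i \<in> fv p'"
    then have i: "i < n + 2" using n by auto
    then consider "i = 0" | "i = 1" | j where "i = Suc (Suc j)" "j < n"
      by (metis One_nat_def add_2_eq_Suc' not0_implies_Suc not_less_eq)
    then show "lv (?E a b x) (Suc (Suc (Suc n))) (([Suc (Suc n), n] @ [0..<n]) ! i)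
        = case_nat x (case_nat a q) i"
      using lv_parameter[of _ n q e] by cases (simp_all add: lv_new lv_old E_def)
  qed
  ultimately show ?thesis by simp
qed

lemma replacement:
  assumes "dterm (\<lambda>e. h (e 0))"
  shows "\<exists>b. \<forall>y. y \<epsilon> b \<longleftrightarrow> (\<exists>x. x \<epsilon> a \<and> y = h x)"
proof -
  obtain p c where
    P: "\<And>e. e 0 = h (e (Suc 0)) \<longleftrightarrow>
      sat UNIV mem (\<lambda>i. if even i then e (i div 2) else c (i div 2)) p"
    using assms unfolding dterm_def definable_def by blast
  \<comment> \<open>The schema has the argument at index 0, the value at 1 and the set at 2. The
    graph of \<open>h\<close> has the value at index 0, every other even index stands for the
    argument, and the parameters move past index 2.\<close>
  define p' where "p' = ren (\<lambda>i. if i = 0 then 1 else if even i then 0 else i + 3) p"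
  define q where "q i = c (i div 2)" for i
  have P': "y = h x \<longleftrightarrow> sat UNIV mem (case_nat x (case_nat y (case_nat a q))) p'" for x y a
  proof -
    have "(\<lambda>i. if even i then case_nat y (\<lambda>_. x) (i div 2) else c (i div 2)) =
        case_nat x (case_nat y (case_nat a q)) \<circ> (\<lambda>i. if i = 0 then 1 else if even i then 0 else i + 3)"
      by (auto simp: q_def fun_eq_iff elim!: evenE oddE split: nat.split)
    then show ?thesis
      using P[of "case_nat y (\<lambda>_. x)"] unfolding p'_def sat_ren by simp
  qed
  obtain n where "fv p' \<subseteq> {..<n}" using finite_fv finite_nat_iff_bounded by blast
  then have n: "fv p' \<subseteq> {..<n + 3}" by auto
  have "Replacement n p' \<in> ZF" using n by (auto simp: ZF_def)
  then obtain e where "sat UNIV mem e (Replacement n p')" using ZF_sat by blast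
  note * = sat_Forall_funpow[OF this[unfolded Replacement_def], of "\<lambda>i. q (n - 1 - i)"]
  define E where "E = (\<lambda>i. if i < n then q (n - 1 - i) else e (i - n))"
  have E: "j < n \<Longrightarrow> lv E n j = q j" for j using lv_parameter[of j n q e] by (simp add: E_def)
  have app: "sat UNIV mem F (f_app p' (u # v # n # [0..<n]) d) \<longleftrightarrow> lv F d v = h (lv F d u)"
    if "\<And>j. j < n \<Longrightarrow> lv F d j = q j" for F d u v
    unfolding sat_form P'[of "lv F d v" "lv F d u" "lv F d n"]
  proof (rule sat_cong)
    fix i assume "i \<in> fv p'"
    then have i: "i < n + 3" using n by auto
    then consider "i = 0" | "i = 1" | "i = 2" | j where "i = Suc (Suc (Suc j))" "j < n"
      by (metis One_nat_def Suc_1 add_Suc_right add.right_neutral eval_nat_numeral(3) less_Suc_eq_0_disj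
          not0_implies_Suc not_less_eq)
    then show "lv F d ((u # v # n # [0..<n]) ! i)
        = case_nat (lv F d u) (case_nat (lv F d v) (case_nat (lv F d n) q)) i"
      using that by cases simp_all
  qed
  from * have "\<forall>a. (\<forall>x y z. x \<epsilon> a \<and> y = h x \<and> z = h x \<longrightarrow> y = z) \<longrightarrow>
      (\<exists>b. \<forall>y. y \<epsilon> b \<longleftrightarrow> (\<exists>x. x \<epsilon> a \<and> y = h x))"
    unfolding E_def[symmetric] by (simp add: sat_simps(1-9) app lv_new lv_old E less_SucI)
  then show ?thesis by blast
qed

lemma extensionality: "(\<And>z. z \<epsilon> x \<longleftrightarrow> z \<epsilon> y) \<Longrightarrow> x = y"
proof -
  obtain e where "sat UNIV mem e Extensionality"
    using ZF_sat[of Extensionality] by (auto simp: ZF_def)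
  then have "\<forall>x y. (\<forall>z. z \<epsilon> x \<longleftrightarrow> z \<epsilon> y) \<longrightarrow> x = y"
    by (simp add: Extensionality_def sat_simps)
  then show "(\<And>z. z \<epsilon> x \<longleftrightarrow> z \<epsilon> y) \<Longrightarrow> x = y" by blast
qed

lemma foundation:
  assumes "y \<epsilon> x"
  shows "\<exists>y. y \<epsilon> x \<and> (\<forall>z. z \<epsilon> x \<longrightarrow> \<not> z \<epsilon> y)"
proof -
  obtain e where "sat UNIV mem e Foundation" using ZF_sat[of Foundation] by (auto simp: ZF_def)
  then have "\<forall>x. \<not> (\<forall>z. \<not> z \<epsilon> x) \<longrightarrow> (\<exists>y. y \<epsilon> x \<and> \<not> (\<exists>z. z \<epsilon> x \<and> z \<epsilon> y))"
    by (simp add: Foundation_def is_empty_def sat_simps)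
  with assms show ?thesis by blast
qed

lemma pairing: "\<exists>p. \<forall>z. z \<epsilon> p \<longleftrightarrow> z = x \<or> z = y"
proof -
  obtain e where "sat UNIV mem e Pairing" using ZF_sat[of Pairing] by (auto simp: ZF_def)
  then show ?thesis by (simp add: Pairing_def is_upair_def sat_simps)
qed

lemma union_ex: "\<exists>u. \<forall>z. z \<epsilon> u \<longleftrightarrow> (\<exists>a. a \<epsilon> A \<and> z \<epsilon> a)"
proof -
  obtain e where "sat UNIV mem e Union_axiom" using ZF_sat[of Union_axiom] by (auto simp: ZF_def)
  then show ?thesis by (simp add: Union_axiom_def is_Union_def sat_simps)
qed

definition Sub :: "'a \<Rightarrow> 'a \<Rightarrow> bool" where
  "Sub x y \<longleftrightarrow> (\<forall>z. z \<epsilon> x \<longrightarrow> z \<epsilon> y)"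

lemma Sub_definable [definable]: "dterm s \<Longrightarrow> dterm t \<Longrightarrow> definable (\<lambda>e. Sub (s e) (t e))"
  by (rule definable_sub2) (unfold Sub_def, intro definable)

lemma power_ex: "\<exists>p. \<forall>z. z \<epsilon> p \<longleftrightarrow> Sub z x"
proof -
  obtain e where "sat UNIV mem e Power_set" using ZF_sat[of Power_set] by (auto simp: ZF_def)
  then show ?thesis by (simp add: Power_set_def f_subset_def sat_simps Sub_def)
qed

definition Inductive :: "'a \<Rightarrow> bool" where
  "Inductive w \<longleftrightarrow> (\<exists>e. e \<epsilon> w \<and> (\<forall>z. \<not> z \<epsilon> e)) \<and>
    (\<forall>x. x \<epsilon> w \<longrightarrow> (\<exists>s. s \<epsilon> w \<and> (\<forall>z. z \<epsilon> s \<longleftrightarrow> z \<epsilon> x \<or> z = x)))"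

lemma Inductive_definable [definable]: "dterm s \<Longrightarrow> definable (\<lambda>e. Inductive (s e))"
  by (rule definable_sub1) (unfold Inductive_def, intro definable)

lemma sat_inductive:
  "w < d \<Longrightarrow> sat UNIV mem e (is_inductive w d) \<longleftrightarrow> Inductive (lv e d w)"
  by (simp add: is_inductive_def is_empty_def is_succ_def Inductive_def sat_simps)

lemma infinity: "\<exists>w. Inductive w"
proof -
  obtain e where "sat UNIV mem e Infinity" using ZF_sat[of Infinity] by (auto simp: ZF_def)
  then show ?thesis by (simp add: Infinity_def sat_inductive sat_simps)
qed

text \<open>Extensionality turns existence of a set into unique existence. Set formers can thus be
  descriptions, which makes them definable terms.\<close>

lemma iota_set:
  assumes "\<exists>b. \<forall>x. x \<epsilon> b \<longleftrightarrow> P x"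
  shows "x \<epsilon> iota (\<lambda>b. \<forall>x. x \<epsilon> b \<longleftrightarrow> P x) \<longleftrightarrow> P x"
proof -
  have "\<exists>!b. \<forall>x. x \<epsilon> b \<longleftrightarrow> P x" using assms extensionality by (metis (full_types))
  from iotaI[OF this] show ?thesis by blast
qed

definition sep :: "'a \<Rightarrow> ('a \<Rightarrow> bool) \<Rightarrow> 'a" where
  "sep a P = iota (\<lambda>b. \<forall>x. x \<epsilon> b \<longleftrightarrow> x \<epsilon> a \<and> P x)"

lemma mem_sep: "definable (\<lambda>e. P (e 0)) \<Longrightarrow> x \<epsilon> sep a P \<longleftrightarrow> x \<epsilon> a \<and> P x"
  unfolding sep_def by (rule iota_set) (rule separation)

definition img :: "'a \<Rightarrow> ('a \<Rightarrow> 'a) \<Rightarrow> 'a" where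
  "img a h = iota (\<lambda>b. \<forall>y. y \<epsilon> b \<longleftrightarrow> (\<exists>x. x \<epsilon> a \<and> y = h x))"

lemma mem_img: "dterm (\<lambda>e. h (e 0)) \<Longrightarrow> y \<epsilon> img a h \<longleftrightarrow> (\<exists>x. x \<epsilon> a \<and> y = h x)"
  unfolding img_def by (rule iota_set) (rule replacement)

lemma sep_definable [definable]:
  assumes "dterm a" "definable (\<lambda>e. P (e 0) (\<lambda>i. e (Suc i)))"
  shows "dterm (\<lambda>e. sep (a e) (\<lambda>x. P x e))"
proof -
  have "definable (\<lambda>e. P (e 0) (\<lambda>i. e (Suc (Suc i))))"
    using definable_ren[OF assms(2), of "\<lambda>i. if i = 0 then 0 else Suc i"] by simp
  then show ?thesis unfolding sep_def by (intro definable dterm_ren[OF assms(1)])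
qed

lemma img_definable [definable]:
  assumes "dterm a" "dterm (\<lambda>e. h (e 0) (\<lambda>i. e (Suc i)))"
  shows "dterm (\<lambda>e. img (a e) (\<lambda>x. h x e))"
proof -
  have "dterm (\<lambda>e. h (e 0) (\<lambda>i. e (Suc (Suc (Suc i)))))"
    using dterm_ren[OF assms(2), of "\<lambda>i. if i = 0 then 0 else Suc (Suc i)"] by simp
  then show ?thesis unfolding img_def by (intro definable dterm_ren[OF assms(1)])
qed

section \<open>Basic set operations\<close>

definition emp :: 'a where "emp = iota (\<lambda>b. \<forall>x. x \<epsilon> b \<longleftrightarrow> False)"
definition upair :: "'a \<Rightarrow> 'a \<Rightarrow> 'a" where
  "upair x y = iota (\<lambda>b. \<forall>z. z \<epsilon> b \<longleftrightarrow> z = x \<or> z = y)"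
definition un :: "'a \<Rightarrow> 'a" where
  "un A = iota (\<lambda>b. \<forall>z. z \<epsilon> b \<longleftrightarrow> (\<exists>a. a \<epsilon> A \<and> z \<epsilon> a))"
definition pow :: "'a \<Rightarrow> 'a" where
  "pow x = iota (\<lambda>b. \<forall>z. z \<epsilon> b \<longleftrightarrow> Sub z x)"
definition cup :: "'a \<Rightarrow> 'a \<Rightarrow> 'a" where "cup a b = un (upair a b)"
definition succ :: "'a \<Rightarrow> 'a" where "succ x = cup x (upair x x)"
definition pair :: "'a \<Rightarrow> 'a \<Rightarrow> 'a" where "pair x y = upair (upair x x) (upair x y)"

lemma mem_emp [simp]: "\<not> x \<epsilon> emp"
  using iota_set[of "\<lambda>_. False"] separation[of "\<lambda>_. False"] definable_const by (simp add: emp_def)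

lemma mem_upair [simp]: "z \<epsilon> upair x y \<longleftrightarrow> z = x \<or> z = y"
  unfolding upair_def by (rule iota_set) (rule pairing)

lemma mem_un: "z \<epsilon> un A \<longleftrightarrow> (\<exists>a. a \<epsilon> A \<and> z \<epsilon> a)"
  unfolding un_def by (rule iota_set) (rule union_ex)

lemma mem_pow [simp]: "z \<epsilon> pow x \<longleftrightarrow> Sub z x"
  unfolding pow_def by (rule iota_set) (rule power_ex)

lemma mem_cup [simp]: "z \<epsilon> cup a b \<longleftrightarrow> z \<epsilon> a \<or> z \<epsilon> b"
  by (auto simp: cup_def mem_un)

lemma mem_succ [simp]: "z \<epsilon> succ x \<longleftrightarrow> z \<epsilon> x \<or> z = x"
  by (simp add: succ_def)

lemma upair_eqI: "(\<And>z. z \<epsilon> p \<longleftrightarrow> z = x \<or> z = y) \<Longrightarrow> p = upair x y"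
  by (rule extensionality) simp

lemma upair_eq: "upair x y = upair u v \<longleftrightarrow> x = u \<and> y = v \<or> x = v \<and> y = u"
proof
  assume eq: "upair x y = upair u v"
  have "z = x \<or> z = y \<longleftrightarrow> z = u \<or> z = v" for z
    using arg_cong[OF eq, of "mem z"] by simp
  then show "x = u \<and> y = v \<or> x = v \<and> y = u" by metis
next
  assume "x = u \<and> y = v \<or> x = v \<and> y = u"
  then show "upair x y = upair u v" by (intro extensionality) auto
qed

lemma pair_eq [simp]: "pair x y = pair u v \<longleftrightarrow> x = u \<and> y = v"
  by (auto simp: pair_def upair_eq)

lemma dterm_sub2:
  assumes "dterm (\<lambda>e. f (e 0) (e 1))" "dterm s" "dterm t"
  shows "dterm (\<lambda>e. f (s e) (t e))"
proof -
  have "definable (\<lambda>e. e 2 = f (e 0) (e 1))"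
    using definable_ren[OF assms(1)[unfolded dterm_def], of "\<lambda>i. if i = 0 then 2 else i - 1"]
    by simp
  then show ?thesis unfolding dterm_def
    using definable_sub3[where P = "\<lambda>x y z. z = f x y", OF _
      dterm_ren[OF assms(2)] dterm_ren[OF assms(3)] dterm_var]
    by blast
qed

lemma upair_definable [definable]: "dterm s \<Longrightarrow> dterm t \<Longrightarrow> dterm (\<lambda>e. upair (s e) (t e))"
  by (rule dterm_sub2) (unfold upair_def, intro definable)

lemma un_definable [definable]: "dterm s \<Longrightarrow> dterm (\<lambda>e. un (s e))"
  by (rule dterm_sub1) (unfold un_def, intro definable)

lemma cup_definable [definable]: "dterm s \<Longrightarrow> dterm t \<Longrightarrow> dterm (\<lambda>e. cup (s e) (t e))"
  unfolding cup_def by (intro definable)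

lemma succ_definable [definable]: "dterm s \<Longrightarrow> dterm (\<lambda>e. succ (s e))"
  unfolding succ_def by (intro definable)

lemma pair_definable [definable]: "dterm s \<Longrightarrow> dterm t \<Longrightarrow> dterm (\<lambda>e. pair (s e) (t e))"
  unfolding pair_def by (intro definable)

lemma mem_irrefl [simp]: "\<not> x \<epsilon> x"
  using foundation[of x "upair x x"] by auto

lemma mem_asym: "x \<epsilon> y \<Longrightarrow> \<not> y \<epsilon> x"
  using foundation[of x "upair x y"] by auto

text \<open>If \<open>x\<close> and \<open>y\<close> were different, each would be an element of the
  other.\<close>

lemma succ_inject [simp]: "succ x = succ y \<longleftrightarrow> x = y"
  by (metis mem_succ mem_asym)

lemma succ_not_emp [simp]: "succ x \<noteq> emp" "emp \<noteq> succ x"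
  by (metis mem_emp mem_succ)+

lemma emp_eqI: "(\<And>z. \<not> z \<epsilon> x) \<Longrightarrow> x = emp"
  by (rule extensionality) simp

section \<open>Functions and natural numbers in a model\<close>

definition Function :: "'a \<Rightarrow> 'a \<Rightarrow> 'a \<Rightarrow> bool" where
  "Function f a b \<longleftrightarrow>
    (\<forall>p. p \<epsilon> f \<longrightarrow> (\<exists>x y. x \<epsilon> a \<and> y \<epsilon> b \<and> p = pair x y)) \<and>
    (\<forall>x. x \<epsilon> a \<longrightarrow> (\<exists>y. pair x y \<epsilon> f \<and> (\<forall>z. pair x z \<epsilon> f \<longrightarrow> z = y)))"

definition Injection :: "'a \<Rightarrow> 'a \<Rightarrow> 'a \<Rightarrow> bool" where
  "Injection f a b \<longleftrightarrow> Function f a b \<and> (\<forall>x z y. pair x y \<epsilon> f \<and> pair z y \<epsilon> f \<longrightarrow> x = z)"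

definition Bijection :: "'a \<Rightarrow> 'a \<Rightarrow> 'a \<Rightarrow> bool" where
  "Bijection f a b \<longleftrightarrow> Injection f a b \<and> (\<forall>y. y \<epsilon> b \<longrightarrow> (\<exists>x. x \<epsilon> a \<and> pair x y \<epsilon> f))"

lemma Function_definable [definable]:
  "dterm s \<Longrightarrow> dterm t \<Longrightarrow> dterm u \<Longrightarrow> definable (\<lambda>e. Function (s e) (t e) (u e))"
  by (rule definable_sub3) (unfold Function_def, intro definable)

lemma Injection_definable [definable]:
  "dterm s \<Longrightarrow> dterm t \<Longrightarrow> dterm u \<Longrightarrow> definable (\<lambda>e. Injection (s e) (t e) (u e))"
  by (rule definable_sub3) (unfold Injection_def, intro definable)

lemma Bijection_definable [definable]:
  "dterm s \<Longrightarrow> dterm t \<Longrightarrow> dterm u \<Longrightarrow> definable (\<lambda>e. Bijection (s e) (t e) (u e))"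
  by (rule definable_sub3) (unfold Bijection_def, intro definable)

definition ap :: "'a \<Rightarrow> 'a \<Rightarrow> 'a" where
  "ap f x = iota (\<lambda>y. pair x y \<epsilon> f)"

lemma ap_definable [definable]: "dterm s \<Longrightarrow> dterm t \<Longrightarrow> dterm (\<lambda>e. ap (s e) (t e))"
  by (rule dterm_sub2) (unfold ap_def, intro definable)

definition lam :: "'a \<Rightarrow> ('a \<Rightarrow> 'a) \<Rightarrow> 'a" where
  "lam a h = img a (\<lambda>x. pair x (h x))"

lemma mem_lam:
  assumes "dterm (\<lambda>e. h (e 0))"
  shows "p \<epsilon> lam a h \<longleftrightarrow> (\<exists>x. x \<epsilon> a \<and> p = pair x (h x))"
  unfolding lam_def by (rule mem_img) (intro definable assms)

lemma pair_mem_lam: "dterm (\<lambda>e. h (e 0)) \<Longrightarrow> pair x y \<epsilon> lam a h \<longleftrightarrow> x \<epsilon> a \<and> y = h x"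
  by (auto simp: mem_lam)

lemma ap_lam: "dterm (\<lambda>e. h (e 0)) \<Longrightarrow> x \<epsilon> a \<Longrightarrow> ap (lam a h) x = h x"
  unfolding ap_def by (rule iota_eq) (simp_all add: pair_mem_lam)

lemma Function_lam:
  assumes "dterm (\<lambda>e. h (e 0))" "\<And>x. x \<epsilon> a \<Longrightarrow> h x \<epsilon> b"
  shows "Function (lam a h) a b"
  unfolding Function_def using assms(2) by (auto simp: mem_lam[OF assms(1)])

lemma Function_ap:
  assumes "Function f a b"
  shows "pair x y \<epsilon> f \<longleftrightarrow> x \<epsilon> a \<and> y = ap f x" and "x \<epsilon> a \<Longrightarrow> ap f x \<epsilon> b"
proof -
  have dom: "x \<epsilon> a \<and> y \<epsilon> b" if "pair x y \<epsilon> f" for x y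
    using assms that unfolding Function_def by (metis pair_eq)
  have ap: "pair x (ap f x) \<epsilon> f \<and> (\<forall>z. pair x z \<epsilon> f \<longrightarrow> z = ap f x)" if x: "x \<epsilon> a" for x
  proof -
    obtain y where y: "pair x y \<epsilon> f" "\<forall>z. pair x z \<epsilon> f \<longrightarrow> z = y"
      using assms x unfolding Function_def by blast
    have "ap f x = y" unfolding ap_def by (rule iota_eq) (rule y(1), rule y(2)[rule_format])
    then show ?thesis using y by metis
  qed
  show "pair x y \<epsilon> f \<longleftrightarrow> x \<epsilon> a \<and> y = ap f x" using dom ap by blast
  show "x \<epsilon> a \<Longrightarrow> ap f x \<epsilon> b" using dom ap by blast
qed

section \<open>Comparison of cardinalities\<close>

definition lepoll :: "'a \<Rightarrow> 'a \<Rightarrow> bool" where "lepoll a b \<longleftrightarrow> (\<exists>f. Injection f a b)"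
definition eqpoll :: "'a \<Rightarrow> 'a \<Rightarrow> bool" where "eqpoll a b \<longleftrightarrow> (\<exists>f. Bijection f a b)"

lemma lepoll_definable [definable]: "dterm s \<Longrightarrow> dterm t \<Longrightarrow> definable (\<lambda>e. lepoll (s e) (t e))"
  by (rule definable_sub2) (unfold lepoll_def, intro definable)

lemma eqpoll_definable [definable]: "dterm s \<Longrightarrow> dterm t \<Longrightarrow> definable (\<lambda>e. eqpoll (s e) (t e))"
  by (rule definable_sub2) (unfold eqpoll_def, intro definable)

text \<open>The rules \<open>lepollI\<close>, \<open>lepollE\<close>, \<open>eqpollI\<close> and
  \<open>eqpollE\<close> trade sets of pairs in the model for definable HOL functions, which can be
  composed and defined by cases directly.\<close>

lemma lepollI:
  assumes "dterm (\<lambda>e. h (e 0))" "\<And>x. x \<epsilon> a \<Longrightarrow> h x \<epsilon> b"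
    "\<And>x y. x \<epsilon> a \<Longrightarrow> y \<epsilon> a \<Longrightarrow> h x = h y \<Longrightarrow> x = y"
  shows "lepoll a b"
proof -
  have "Injection (lam a h) a b"
    unfolding Injection_def using assms(3) Function_lam[OF assms(1,2)]
    by (auto simp: pair_mem_lam[OF assms(1)])
  then show ?thesis unfolding lepoll_def by blast
qed

lemma lepollE:
  assumes "lepoll a b"
  obtains h where "dterm (\<lambda>e. h (e 0))" "\<And>x. x \<epsilon> a \<Longrightarrow> h x \<epsilon> b"
    "\<And>x y. x \<epsilon> a \<Longrightarrow> y \<epsilon> a \<Longrightarrow> h x = h y \<Longrightarrow> x = y"
proof -
  obtain f where f: "Function f a b" "\<And>x z y. pair x y \<epsilon> f \<Longrightarrow> pair z y \<epsilon> f \<Longrightarrow> x = z"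
    using assms unfolding lepoll_def Injection_def by blast
  show thesis
  proof (rule that[of "ap f"])
    show "dterm (\<lambda>e. ap f (e 0))" by (intro definable)
    show "ap f x \<epsilon> b" if "x \<epsilon> a" for x using Function_ap[OF f(1)] that by blast
    show "x = y" if "x \<epsilon> a" "y \<epsilon> a" "ap f x = ap f y" for x y
      using f(2)[of x "ap f x" y] Function_ap(1)[OF f(1)] that by simp
  qed
qed

lemma eqpollI:
  assumes "dterm (\<lambda>e. h (e 0))" "\<And>x. x \<epsilon> a \<Longrightarrow> h x \<epsilon> b"
    "\<And>x y. x \<epsilon> a \<Longrightarrow> y \<epsilon> a \<Longrightarrow> h x = h y \<Longrightarrow> x = y"
    "\<And>y. y \<epsilon> b \<Longrightarrow> \<exists>x. x \<epsilon> a \<and> h x = y"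
  shows "eqpoll a b"
proof -
  have "\<exists>x. x \<epsilon> a \<and> y = h x" if "y \<epsilon> b" for y using assms(4)[OF that] by blast
  then have "Bijection (lam a h) a b"
    unfolding Bijection_def Injection_def using assms(3) Function_lam[OF assms(1,2)]
    by (auto simp: pair_mem_lam[OF assms(1)])
  then show ?thesis unfolding eqpoll_def by blast
qed

lemma eqpollE:
  assumes "eqpoll a b"
  obtains h where "dterm (\<lambda>e. h (e 0))" "\<And>x. x \<epsilon> a \<Longrightarrow> h x \<epsilon> b"
    "\<And>x y. x \<epsilon> a \<Longrightarrow> y \<epsilon> a \<Longrightarrow> h x = h y \<Longrightarrow> x = y"
    "\<And>y. y \<epsilon> b \<Longrightarrow> \<exists>x. x \<epsilon> a \<and> h x = y"
proof -
  obtain f where f: "Function f a b" "\<And>x z y. pair x y \<epsilon> f \<Longrightarrow> pair z y \<epsilon> f \<Longrightarrow> x = z"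
      "\<And>y. y \<epsilon> b \<Longrightarrow> \<exists>x. x \<epsilon> a \<and> pair x y \<epsilon> f"
    using assms unfolding eqpoll_def Bijection_def Injection_def by blast
  show thesis
  proof (rule that[of "ap f"])
    show "dterm (\<lambda>e. ap f (e 0))" by (intro definable)
    show "ap f x \<epsilon> b" if "x \<epsilon> a" for x using Function_ap[OF f(1)] that by blast
    show "x = y" if "x \<epsilon> a" "y \<epsilon> a" "ap f x = ap f y" for x y
      using f(2)[of x "ap f x" y] Function_ap(1)[OF f(1)] that by simp
    show "\<exists>x. x \<epsilon> a \<and> ap f x = y" if "y \<epsilon> b" for y
      using f(3)[OF that] Function_ap(1)[OF f(1)] by auto
  qed
qed

lemma eqpoll_lepoll: "eqpoll a b \<Longrightarrow> lepoll a b"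
  unfolding eqpoll_def lepoll_def Bijection_def by blast

lemma lepoll_refl: "lepoll a a"
  by (rule lepollI[of "\<lambda>x. x"]) (auto intro: definable)

lemma eqpoll_sym:
  assumes "eqpoll a b"
  shows "eqpoll b a"
proof -
  obtain h where h: "dterm (\<lambda>e. h (e 0))" "\<And>x. x \<epsilon> a \<Longrightarrow> h x \<epsilon> b"
    "\<And>x y. x \<epsilon> a \<Longrightarrow> y \<epsilon> a \<Longrightarrow> h x = h y \<Longrightarrow> x = y" "\<And>y. y \<epsilon> b \<Longrightarrow> \<exists>x. x \<epsilon> a \<and> h x = y"
    using eqpollE[OF assms] by blast
  define g where "g y = iota (\<lambda>x. x \<epsilon> a \<and> h x = y)" for y
  have g: "g (h x) = x" if "x \<epsilon> a" for x
    unfolding g_def by (rule iota_eq) (use that h(3) in auto)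
  show ?thesis
  proof (rule eqpollI[of g])
    show "dterm (\<lambda>e. g (e 0))" unfolding g_def by (intro definable dterm_sub1[OF h(1)])
    show "g y \<epsilon> a" if "y \<epsilon> b" for y using h(4)[OF that] g by auto
    show "x = y" if "x \<epsilon> b" "y \<epsilon> b" "g x = g y" for x y
      using h(4)[OF that(1)] h(4)[OF that(2)] g that(3) by metis
    show "\<exists>x. x \<epsilon> b \<and> g x = y" if "y \<epsilon> a" for y using g h(2) that by blast
  qed
qed

lemma lepoll_trans:
  assumes "lepoll a b" "lepoll b c"
  shows "lepoll a c"
proof -
  obtain h where h: "dterm (\<lambda>e. h (e 0))" "\<And>x. x \<epsilon> a \<Longrightarrow> h x \<epsilon> b"
    "\<And>x y. x \<epsilon> a \<Longrightarrow> y \<epsilon> a \<Longrightarrow> h x = h y \<Longrightarrow> x = y"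
    using lepollE[OF assms(1)] by blast
  obtain g where g: "dterm (\<lambda>e. g (e 0))" "\<And>x. x \<epsilon> b \<Longrightarrow> g x \<epsilon> c"
    "\<And>x y. x \<epsilon> b \<Longrightarrow> y \<epsilon> b \<Longrightarrow> g x = g y \<Longrightarrow> x = y"
    using lepollE[OF assms(2)] by blast
  show ?thesis
  proof (rule lepollI[of "\<lambda>x. g (h x)"])
    show "dterm (\<lambda>e. g (h (e 0)))" by (rule dterm_sub1[OF g(1) h(1)])
  qed (use g h in blast)+
qed

lemma eqpoll_trans:
  assumes "eqpoll a b" "eqpoll b c"
  shows "eqpoll a c"
proof -
  obtain h where h: "dterm (\<lambda>e. h (e 0))" "\<And>x. x \<epsilon> a \<Longrightarrow> h x \<epsilon> b"
    "\<And>x y. x \<epsilon> a \<Longrightarrow> y \<epsilon> a \<Longrightarrow> h x = h y \<Longrightarrow> x = y" "\<And>y. y \<epsilon> b \<Longrightarrow> \<exists>x. x \<epsilon> a \<and> h x = y"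
    using eqpollE[OF assms(1)] by blast
  obtain g where g: "dterm (\<lambda>e. g (e 0))" "\<And>x. x \<epsilon> b \<Longrightarrow> g x \<epsilon> c"
    "\<And>x y. x \<epsilon> b \<Longrightarrow> y \<epsilon> b \<Longrightarrow> g x = g y \<Longrightarrow> x = y" "\<And>y. y \<epsilon> c \<Longrightarrow> \<exists>x. x \<epsilon> b \<and> g x = y"
    using eqpollE[OF assms(2)] by blast
  show ?thesis
  proof (rule eqpollI[of "\<lambda>x. g (h x)"])
    show "dterm (\<lambda>e. g (h (e 0)))" by (rule dterm_sub1[OF g(1) h(1)])
    show "\<exists>x. x \<epsilon> a \<and> g (h x) = y" if "y \<epsilon> c" for y using h(4) g(4)[OF that] by blast
  qed (use g(2,3) h(2,3) in blast)+
qed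

lemma lepoll_Sub: "Sub a b \<Longrightarrow> lepoll a b"
  by (rule lepollI[of "\<lambda>x. x"]) (auto intro: definable simp: Sub_def)

lemma lepoll_img_eqpoll:
  assumes "dterm (\<lambda>e. h (e 0))" "\<And>x y. x \<epsilon> a \<Longrightarrow> y \<epsilon> a \<Longrightarrow> h x = h y \<Longrightarrow> x = y"
  shows "eqpoll a (img a h)"
  by (rule eqpollI[of h]) (use assms in \<open>auto simp: mem_img[OF assms(1)]\<close>)

section \<open>The natural numbers of the model\<close>

definition omega :: 'a where
  "omega = iota (\<lambda>w. \<forall>x. x \<epsilon> w \<longleftrightarrow> (\<forall>I. Inductive I \<longrightarrow> x \<epsilon> I))"

lemma mem_omega: "x \<epsilon> omega \<longleftrightarrow> (\<forall>I. Inductive I \<longrightarrow> x \<epsilon> I)"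
proof -
  obtain w where "Inductive w" using infinity by blast
  moreover have "\<exists>b. \<forall>x. x \<epsilon> b \<longleftrightarrow> x \<epsilon> w \<and> (\<forall>I. Inductive I \<longrightarrow> x \<epsilon> I)"
    by (rule separation) (intro definable)
  ultimately show ?thesis unfolding omega_def by (intro iota_set) blast
qed

lemma Inductive_iff: "Inductive w \<longleftrightarrow> emp \<epsilon> w \<and> (\<forall>x. x \<epsilon> w \<longrightarrow> succ x \<epsilon> w)"
proof -
  have "(\<forall>z. \<not> z \<epsilon> e) \<longleftrightarrow> e = emp" for e using emp_eqI by auto
  moreover have "(\<forall>z. z \<epsilon> s \<longleftrightarrow> z \<epsilon> x \<or> z = x) \<longleftrightarrow> s = succ x" for s x
    using extensionality[of s "succ x"] by auto
  ultimately show ?thesis unfolding Inductive_def by simp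
qed

lemma emp_omega [simp]: "emp \<epsilon> omega"
  and succ_omega [simp]: "x \<epsilon> omega \<Longrightarrow> succ x \<epsilon> omega"
  by (auto simp: mem_omega Inductive_iff)

text \<open>The left side is the content of the formula \<open>is_omega\<close>, which is thereby
  tied to the constant \<open>omega\<close>.\<close>

lemma Omega_iff: "Inductive w \<and> (\<forall>x. Inductive x \<longrightarrow> Sub w x) \<longleftrightarrow> w = omega"
proof
  assume w: "Inductive w \<and> (\<forall>x. Inductive x \<longrightarrow> Sub w x)"
  show "w = omega" by (rule extensionality) (use w in \<open>auto simp: mem_omega Sub_def\<close>)
next
  have "Inductive omega" by (simp add: Inductive_iff)
  moreover have "Sub omega x" if "Inductive x" for x using that by (simp add: Sub_def mem_omega)
  ultimately show "w = omega \<Longrightarrow> Inductive w \<and> (\<forall>x. Inductive x \<longrightarrow> Sub w x)" by blast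
qed

text \<open>Separation by \<open>P\<close> yields an inductive subset of \<open>omega\<close>.
  Definability is essential: seen from outside, \<open>omega\<close> may contain nonstandard
  numbers, which induction over the HOL naturals does not reach.\<close>

lemma omega_induct:
  assumes "n \<epsilon> omega" "definable (\<lambda>e. P (e 0))" "P emp" "\<And>n. n \<epsilon> omega \<Longrightarrow> P n \<Longrightarrow> P (succ n)"
  shows "P n"
proof -
  have "Inductive (sep omega P)" using assms(3,4) by (simp add: Inductive_iff mem_sep[OF assms(2)])
  then have "n \<epsilon> sep omega P" using assms(1) unfolding mem_omega by blast
  then show ?thesis by (simp add: mem_sep[OF assms(2)])
qed

lemma omega_cases:
  assumes "n \<epsilon> omega"
  shows "n = emp \<or> (\<exists>m. m \<epsilon> omega \<and> n = succ m)"
  using assms by (rule omega_induct) (intro definable, auto)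

lemma omega_transitive:
  assumes "n \<epsilon> omega"
  shows "\<forall>x. x \<epsilon> n \<longrightarrow> x \<epsilon> omega"
  using assms by (rule omega_induct) (intro definable, auto)

lemma omega_mem_trans_all:
  assumes "n \<epsilon> omega"
  shows "\<forall>x y. x \<epsilon> y \<and> y \<epsilon> n \<longrightarrow> x \<epsilon> n"
  using assms by (rule omega_induct) (intro definable, auto)

lemma omega_mem: "x \<epsilon> n \<Longrightarrow> n \<epsilon> omega \<Longrightarrow> x \<epsilon> omega"
  using omega_transitive by blast

lemma omega_trans: "x \<epsilon> y \<Longrightarrow> y \<epsilon> n \<Longrightarrow> n \<epsilon> omega \<Longrightarrow> x \<epsilon> n"
  using omega_mem_trans_all by blast

lemma emp_mem_succ:
  assumes "n \<epsilon> omega"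
  shows "emp \<epsilon> succ n"
  using assms by (rule omega_induct) (intro definable, auto)

lemma succ_mem_succ_all:
  assumes "n \<epsilon> omega"
  shows "\<forall>m. m \<epsilon> n \<longrightarrow> succ m \<epsilon> succ n"
  using assms by (rule omega_induct) (intro definable, auto)

lemma succ_mem_succ: "m \<epsilon> n \<Longrightarrow> n \<epsilon> omega \<Longrightarrow> succ m \<epsilon> succ n"
  using succ_mem_succ_all by blast

lemma omega_linear_all:
  assumes "n \<epsilon> omega"
  shows "\<forall>m. m \<epsilon> omega \<longrightarrow> m \<epsilon> n \<or> m = n \<or> n \<epsilon> m"
  using assms
proof (rule omega_induct)
  show "definable (\<lambda>e. \<forall>m. m \<epsilon> omega \<longrightarrow> m \<epsilon> e 0 \<or> m = e 0 \<or> e 0 \<epsilon> m)" by (intro definable)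
  show "\<forall>m. m \<epsilon> omega \<longrightarrow> m \<epsilon> emp \<or> m = emp \<or> emp \<epsilon> m"
    using omega_cases emp_mem_succ by blast
  fix n assume n: "n \<epsilon> omega" "\<forall>m. m \<epsilon> omega \<longrightarrow> m \<epsilon> n \<or> m = n \<or> n \<epsilon> m"
  show "\<forall>m. m \<epsilon> omega \<longrightarrow> m \<epsilon> succ n \<or> m = succ n \<or> succ n \<epsilon> m"
  proof (intro allI impI)
    fix m assume m: "m \<epsilon> omega"
    show "m \<epsilon> succ n \<or> m = succ n \<or> succ n \<epsilon> m"
    proof (cases "n \<epsilon> m")
      case True
      then have "succ n \<epsilon> succ m" using m succ_mem_succ by blast
      then show ?thesis by auto
    next
      case False
      then show ?thesis using n(2) m by auto
    qed
  qed
qed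

lemma omega_linear: "m \<epsilon> omega \<Longrightarrow> n \<epsilon> omega \<Longrightarrow> m \<epsilon> n \<or> m = n \<or> n \<epsilon> m"
  using omega_linear_all by blast

text \<open>A definable minimum, which replaces choices from nonempty sets of numbers.\<close>

definition least_omega :: "('a \<Rightarrow> bool) \<Rightarrow> 'a" where
  "least_omega P = iota (\<lambda>m. m \<epsilon> omega \<and> P m \<and> (\<forall>k. k \<epsilon> m \<longrightarrow> \<not> P k))"

lemma least_omega_definable [definable]:
  assumes "definable (\<lambda>e. P (e 0) (\<lambda>i. e (Suc i)))"
  shows "dterm (\<lambda>e. least_omega (\<lambda>x. P x e))"
proof -
  have "definable (\<lambda>e. P (e 0) (\<lambda>i. e (Suc (Suc i))))"
    using definable_ren[OF assms, of "\<lambda>i. if i = 0 then 0 else Suc i"] by simp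
  then show ?thesis unfolding least_omega_def by (intro definable assms)
qed

text \<open>Foundation provides a minimal element, and linearity of \<open>omega\<close> makes it
  the only one, so the description succeeds.\<close>

lemma least_omega:
  assumes "definable (\<lambda>e. P (e 0))" "n \<epsilon> omega" "P n"
  shows "least_omega P \<epsilon> omega" "P (least_omega P)" "\<And>k. k \<epsilon> least_omega P \<Longrightarrow> \<not> P k"
proof -
  have "n \<epsilon> sep omega P" using assms(2,3) by (simp add: mem_sep[OF assms(1)])
  then obtain m where m: "m \<epsilon> omega" "P m" "\<And>z. z \<epsilon> omega \<Longrightarrow> P z \<Longrightarrow> \<not> z \<epsilon> m"
    using foundation by (metis mem_sep[OF assms(1)])
  have "least_omega P = m"
    unfolding least_omega_def
  proof (rule iota_eq)
    show "m \<epsilon> omega \<and> P m \<and> (\<forall>k. k \<epsilon> m \<longrightarrow> \<not> P k)" using m omega_mem by blast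
    show "y = m" if "y \<epsilon> omega \<and> P y \<and> (\<forall>k. k \<epsilon> y \<longrightarrow> \<not> P k)" for y
      using that m omega_linear by blast
  qed
  then show "least_omega P \<epsilon> omega" "P (least_omega P)" "\<And>k. k \<epsilon> least_omega P \<Longrightarrow> \<not> P k"
    using m omega_mem by blast+
qed

text \<open>Finite approximations exist by induction and agree where both are constrained, so their
  common value is describable. This makes \<open>F\<close> definable, so that it can be used in
  later inductions and replacements.\<close>

lemma recursion:
  assumes G: "dterm (\<lambda>e. G (e 0) (e 1))"
  obtains F where "dterm (\<lambda>e. F (e 0))" "F emp = z" "\<And>n. n \<epsilon> omega \<Longrightarrow> F (succ n) = G n (F n)"
proof -
  \<comment> \<open>Only the values of \<open>ap f\<close> up to \<open>n\<close> are constrained;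
    \<open>f\<close> may be any set. Hence an approximation for \<open>succ n\<close> is also one
    for \<open>n\<close>.\<close>
  define App where "App n f \<longleftrightarrow> ap f emp = z \<and> (\<forall>k. k \<epsilon> n \<longrightarrow> ap f (succ k) = G k (ap f k))" for n f
  have App_definable: "definable (\<lambda>e. App (s e) (t e))" if "dterm s" "dterm t" for s t
    by (rule definable_sub2[OF _ that]) (unfold App_def, intro definable dterm_sub2[OF G])
  have ex: "\<exists>f. App n f" if "n \<epsilon> omega" for n
    using that
  proof (rule omega_induct)
    show "definable (\<lambda>e. \<exists>f. App (e 0) f)" by (intro definable App_definable)
    have "ap (lam (succ emp) (\<lambda>_. z)) emp = z" by (rule ap_lam) (simp_all add: definable)
    then show "\<exists>f. App emp f" unfolding App_def by auto
    fix n assume n: "n \<epsilon> omega" "\<exists>f. App n f"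
    then obtain f where f: "App n f" by blast
    \<comment> \<open>Extends the approximation by its next value, at the argument
      \<open>succ n\<close>.\<close>
    define h where "h k = (if k = succ n then G n (ap f n) else ap f k)" for k
    have h: "dterm (\<lambda>e. h (e 0))" unfolding h_def by (intro definable)
    have nn: "n \<noteq> succ n" by (metis mem_irrefl mem_succ)
    let ?g = "lam (succ (succ n)) h"
    have g: "ap ?g k = h k" if "k \<epsilon> succ (succ n)" for k using ap_lam[OF h that] .
    have "App (succ n) ?g"
      unfolding App_def
    proof (intro conjI allI impI)
      show "ap ?g emp = z"
        using g[of emp] f n(1) emp_mem_succ[of "succ n"] by (simp add: h_def App_def)
      fix k assume k: "k \<epsilon> succ n"
      have "succ k \<epsilon> succ (succ n)" using succ_mem_succ[OF k] n(1) by simp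
      moreover have "k \<noteq> succ n" using k by (metis mem_irrefl)
      moreover have "k \<epsilon> succ (succ n)" using k by simp
      ultimately show "ap ?g (succ k) = G k (ap ?g k)"
        using k f g[of k] g[of "succ k"] by (auto simp: h_def App_def)
    qed
    then show "\<exists>f. App (succ n) f" by blast
  qed
  have uniq: "ap f n = ap g n" if "n \<epsilon> omega" "App n f" "App n g" for n f g
  proof -
    have "k \<epsilon> succ n \<longrightarrow> ap f k = ap g k" if "k \<epsilon> omega" for k
      using that
    proof (rule omega_induct)
      show "definable (\<lambda>e. e 0 \<epsilon> succ n \<longrightarrow> ap f (e 0) = ap g (e 0))" by (intro definable)
      show "emp \<epsilon> succ n \<longrightarrow> ap f emp = ap g emp"
        using \<open>App n f\<close> \<open>App n g\<close> by (simp add: App_def)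
      fix k assume k: "k \<epsilon> omega" "k \<epsilon> succ n \<longrightarrow> ap f k = ap g k"
      show "succ k \<epsilon> succ n \<longrightarrow> ap f (succ k) = ap g (succ k)"
      proof
        assume "succ k \<epsilon> succ n"
        then have "k \<epsilon> n" using omega_trans[of k "succ k" n] \<open>n \<epsilon> omega\<close> by auto
        with k \<open>App n f\<close> \<open>App n g\<close> show "ap f (succ k) = ap g (succ k)" by (simp add: App_def)
      qed
    qed
    then show ?thesis using that(1) by simp
  qed
  define F where "F n = iota (\<lambda>y. \<exists>f. App n f \<and> y = ap f n)" for n
  have F: "F n = ap f n" if "n \<epsilon> omega" "App n f" for n f
    unfolding F_def by (rule iota_eq) (use that uniq in metis)+
  show thesis
  proof
    show "dterm (\<lambda>e. F (e 0))" unfolding F_def by (intro definable App_definable)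
    show "F emp = z" using ex[of emp] F[of emp] by (auto simp: App_def)
    fix n assume n: "n \<epsilon> omega"
    then obtain f where f: "App (succ n) f" using ex succ_omega by blast
    then have "App n f" by (simp add: App_def)
    then have "F n = ap f n" using F n by blast
    moreover have "F (succ n) = ap f (succ n)" using F f n by simp
    ultimately show "F (succ n) = G n (F n)" using f by (simp add: App_def)
  qed
qed

section \<open>Countability in a model\<close>

definition Finite :: "'a \<Rightarrow> bool" where "Finite a \<longleftrightarrow> (\<exists>n. n \<epsilon> omega \<and> eqpoll n a)"
definition Denumerable :: "'a \<Rightarrow> bool" where "Denumerable a \<longleftrightarrow> eqpoll omega a"

lemma eqpoll_refl: "eqpoll a a"
  by (rule eqpollI[of "\<lambda>x. x"]) (auto intro: definable)

lemma lepoll_omega_if_countable: "Finite a \<or> Denumerable a \<Longrightarrow> lepoll a omega"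
proof -
  have "lepoll n omega" if "n \<epsilon> omega" for n
    by (rule lepoll_Sub) (use that omega_mem in \<open>auto simp: Sub_def\<close>)
  then show "Finite a \<or> Denumerable a \<Longrightarrow> lepoll a omega"
    unfolding Finite_def Denumerable_def using eqpoll_sym eqpoll_lepoll lepoll_trans by blast
qed

text \<open>The induction treats all \<open>S\<close> at once. If \<open>n\<close> lies in
  \<open>S\<close>, a numbering of the remaining elements by \<open>k\<close> is extended by sending
  the new index \<open>k\<close> to \<open>n\<close>.\<close>

lemma Finite_if_Sub_omega:
  assumes "n \<epsilon> omega"
  shows "\<forall>S. Sub S n \<longrightarrow> (\<exists>k. k \<epsilon> omega \<and> eqpoll k S)"
  using assms
proof (rule omega_induct)
  show "definable (\<lambda>e. \<forall>S. Sub S (e 0) \<longrightarrow> (\<exists>k. k \<epsilon> omega \<and> eqpoll k S))" by (intro definable)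
  have "S = emp" if "Sub S emp" for S using that emp_eqI by (simp add: Sub_def)
  then show "\<forall>S. Sub S emp \<longrightarrow> (\<exists>k. k \<epsilon> omega \<and> eqpoll k S)" using eqpoll_refl emp_omega by metis
next
  fix n assume n: "n \<epsilon> omega" and IH: "\<forall>S. Sub S n \<longrightarrow> (\<exists>k. k \<epsilon> omega \<and> eqpoll k S)"
  show "\<forall>S. Sub S (succ n) \<longrightarrow> (\<exists>k. k \<epsilon> omega \<and> eqpoll k S)"
  proof (intro allI impI)
    fix S assume S: "Sub S (succ n)"
    show "\<exists>k. k \<epsilon> omega \<and> eqpoll k S"
    proof (cases "n \<epsilon> S")
      case False
      then have "Sub S n" using S by (auto simp: Sub_def)
      then show ?thesis using IH by blast
    next
      case True
      define T where "T = sep S (\<lambda>x. x \<noteq> n)"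
      have T: "x \<epsilon> T \<longleftrightarrow> x \<epsilon> S \<and> x \<noteq> n" for x unfolding T_def by (rule mem_sep) (intro definable)
      have "Sub T n" using S by (auto simp: Sub_def T)
      then obtain k where k: "k \<epsilon> omega" "eqpoll k T" using IH by blast
      obtain h where h: "dterm (\<lambda>e. h (e 0))" "\<And>x. x \<epsilon> k \<Longrightarrow> h x \<epsilon> T"
        "\<And>x y. x \<epsilon> k \<Longrightarrow> y \<epsilon> k \<Longrightarrow> h x = h y \<Longrightarrow> x = y" "\<And>y. y \<epsilon> T \<Longrightarrow> \<exists>x. x \<epsilon> k \<and> h x = y"
        using eqpollE[OF k(2)] by blast
      define g where "g x = (if x = k then n else h x)" for x
      have gk: "g k = n" and gh: "\<And>x. x \<epsilon> k \<Longrightarrow> g x = h x" by (auto simp: g_def)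
      have "eqpoll (succ k) S"
      proof (rule eqpollI[of g])
        show "dterm (\<lambda>e. g (e 0))" unfolding g_def by (intro definable h(1))
        show "g x \<epsilon> S" if "x \<epsilon> succ k" for x using that h(2) True by (auto simp: gk gh T)
        show "x = y" if "x \<epsilon> succ k" "y \<epsilon> succ k" "g x = g y" for x y
          using that h(2)[of x] h(2)[of y] h(3)[of x y] by (auto simp: gk gh T)
        show "\<exists>x. x \<epsilon> succ k \<and> g x = y" if "y \<epsilon> S" for y
        proof (cases "y = n")
          case True
          then show ?thesis using gk by auto
        next
          case False
          then obtain x where "x \<epsilon> k" "h x = y" using h(4) T \<open>y \<epsilon> S\<close> by blast
          then show ?thesis using gh by auto
        qed
      qed
      then show ?thesis using k(1) succ_omega by blast
    qed
  qed
qed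

text \<open>A bounded set is contained in a number. An unbounded one is enumerated in increasing
  order by \<open>F\<close>.\<close>

lemma countable_if_Sub_omega:
  assumes S: "Sub S omega"
  shows "Finite S \<or> Denumerable S"
proof (cases "\<exists>m. m \<epsilon> omega \<and> Sub S m")
  case True
  then show ?thesis using Finite_if_Sub_omega unfolding Finite_def by blast
next
  case False
  have unb: "\<exists>s. s \<epsilon> omega \<and> s \<epsilon> S \<and> \<not> s \<epsilon> m" if "m \<epsilon> omega" for m
    using False that S by (auto simp: Sub_def)
  \<comment> \<open>On numbers, "not an element of \<open>m\<close>" means "at least
    \<open>m\<close>". So \<open>nxt (succ x)\<close> is the least element of \<open>S\<close>
    strictly above \<open>x\<close>.\<close>
  define nxt where "nxt m = least_omega (\<lambda>s. s \<epsilon> S \<and> \<not> s \<epsilon> m)" for m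
  have nxt_definable: "dterm (\<lambda>e. nxt (s e))" if "dterm s" for s
    by (rule dterm_sub1[OF _ that]) (unfold nxt_def, intro definable)
  have nxt: "nxt m \<epsilon> omega" "nxt m \<epsilon> S" "\<not> nxt m \<epsilon> m" "\<And>k. k \<epsilon> nxt m \<Longrightarrow> k \<epsilon> S \<Longrightarrow> k \<epsilon> m"
    if m: "m \<epsilon> omega" for m
  proof -
    have D: "definable (\<lambda>e. e 0 \<epsilon> S \<and> \<not> e 0 \<epsilon> m)" by (intro definable)
    obtain s where s: "s \<epsilon> omega" "s \<epsilon> S \<and> \<not> s \<epsilon> m" using unb[OF m] by blast
    note l = least_omega[where P = "\<lambda>s. s \<epsilon> S \<and> \<not> s \<epsilon> m", OF D s, folded nxt_def]
    show "nxt m \<epsilon> omega" "nxt m \<epsilon> S" "\<not> nxt m \<epsilon> m" using l(1,2) by auto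
    show "k \<epsilon> m" if "k \<epsilon> nxt m" "k \<epsilon> S" for k using l(3)[OF that(1)] that(2) by blast
  qed
  have "dterm (\<lambda>e. nxt (succ (e 1)))" by (intro nxt_definable definable)
  from recursion[where G = "\<lambda>_ x. nxt (succ x)", OF this]
  obtain F where F: "dterm (\<lambda>e. F (e 0))" "F emp = nxt emp"
    "\<And>n. n \<epsilon> omega \<Longrightarrow> F (succ n) = nxt (succ (F n))" by blast
  have FS: "F n \<epsilon> omega \<and> F n \<epsilon> S" if "n \<epsilon> omega" for n
    using that
  proof (rule omega_induct)
    show "definable (\<lambda>e. F (e 0) \<epsilon> omega \<and> F (e 0) \<epsilon> S)" by (intro definable F(1))
  qed (use nxt F(2,3) in auto)
  have F_less_succ: "F n \<epsilon> F (succ n)" if n: "n \<epsilon> omega" for n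
  proof -
    have "\<not> F (succ n) \<epsilon> succ (F n)" using nxt(3)[of "succ (F n)"] F(3) FS n by simp
    then show ?thesis using omega_linear FS n succ_omega by (metis mem_succ)
  qed
  have F_mono: "\<forall>k. k \<epsilon> n \<longrightarrow> F k \<epsilon> F n" if "n \<epsilon> omega" for n
    using that
  proof (rule omega_induct)
    show "definable (\<lambda>e. \<forall>k. k \<epsilon> e 0 \<longrightarrow> F k \<epsilon> F (e 0))" by (intro definable dterm_sub1[OF F(1)])
    fix n assume "n \<epsilon> omega" "\<forall>k. k \<epsilon> n \<longrightarrow> F k \<epsilon> F n"
    then show "\<forall>k. k \<epsilon> succ n \<longrightarrow> F k \<epsilon> F (succ n)"
      using F_less_succ FS omega_trans succ_omega by (metis mem_succ)
  qed simp
  have F_surj: "\<forall>s. s \<epsilon> S \<and> s \<epsilon> F n \<longrightarrow> (\<exists>k. k \<epsilon> n \<and> s = F k)" if "n \<epsilon> omega" for n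
    using that
  proof (rule omega_induct)
    show "definable (\<lambda>e. \<forall>s. s \<epsilon> S \<and> s \<epsilon> F (e 0) \<longrightarrow> (\<exists>k. k \<epsilon> e 0 \<and> s = F k))"
      by (intro definable dterm_sub1[OF F(1)])
    show "\<forall>s. s \<epsilon> S \<and> s \<epsilon> F emp \<longrightarrow> (\<exists>k. k \<epsilon> emp \<and> s = F k)"
      using nxt(4)[OF emp_omega] F(2) mem_emp by metis
    fix n assume n: "n \<epsilon> omega" "\<forall>s. s \<epsilon> S \<and> s \<epsilon> F n \<longrightarrow> (\<exists>k. k \<epsilon> n \<and> s = F k)"
    show "\<forall>s. s \<epsilon> S \<and> s \<epsilon> F (succ n) \<longrightarrow> (\<exists>k. k \<epsilon> succ n \<and> s = F k)"
      using nxt(4)[of "succ (F n)"] F(3) n FS succ_omega by (metis mem_succ)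
  qed
  \<comment> \<open>An increasing enumeration satisfies \<open>n \<le> F n\<close>. Thus every
    \<open>s\<close> in \<open>S\<close> is at most \<open>F s\<close>, and \<open>F_surj\<close>
    finds it among the values up to there.\<close>
  have F_ge: "\<not> F n \<epsilon> n" if "n \<epsilon> omega" for n
    using that
  proof (rule omega_induct)
    show "definable (\<lambda>e. \<not> F (e 0) \<epsilon> e 0)" by (intro definable F(1))
    fix n assume n: "n \<epsilon> omega" "\<not> F n \<epsilon> n"
    show "\<not> F (succ n) \<epsilon> succ n"
      using F_less_succ[OF n(1)] omega_trans[of "F n" "F (succ n)" n] n by auto
  qed simp
  have "Denumerable S"
    unfolding Denumerable_def
  proof (rule eqpollI[of F])
    show "dterm (\<lambda>e. F (e 0))" by (rule F(1))
    show "F n \<epsilon> S" if "n \<epsilon> omega" for n using FS that by blast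
    show "m = n" if "m \<epsilon> omega" "n \<epsilon> omega" "F m = F n" for m n
      using omega_linear[OF that(1,2)] F_mono that by (metis mem_irrefl)
    show "\<exists>n. n \<epsilon> omega \<and> F n = s" if s: "s \<epsilon> S" for s
    proof -
      have omega: "s \<epsilon> omega" using S s by (simp add: Sub_def)
      then have "s \<epsilon> F s \<or> s = F s" using omega_linear F_ge FS by blast
      then show ?thesis using F_surj[OF omega] s omega omega_mem by metis
    qed
  qed
  then show ?thesis ..
qed

text \<open>The image of an injection is a subset of \<open>omega\<close>. From here on countability
  is handled as \<open>lepoll a omega\<close>, which covers the finite and the denumerable case
  together.\<close>

lemma countable_iff_lepoll_omega: "Finite a \<or> Denumerable a \<longleftrightarrow> lepoll a omega"
proof
  assume "lepoll a omega"
  then obtain h where h: "dterm (\<lambda>e. h (e 0))" "\<And>x. x \<epsilon> a \<Longrightarrow> h x \<epsilon> omega"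
    "\<And>x y. x \<epsilon> a \<Longrightarrow> y \<epsilon> a \<Longrightarrow> h x = h y \<Longrightarrow> x = y"
    using lepollE by blast
  have "Sub (img a h) omega" using h(2) by (auto simp: Sub_def mem_img[OF h(1)])
  moreover have "eqpoll (img a h) a" using eqpoll_sym lepoll_img_eqpoll h by blast
  ultimately show "Finite a \<or> Denumerable a"
    using countable_if_Sub_omega eqpoll_trans unfolding Finite_def Denumerable_def by blast
qed (rule lepoll_omega_if_countable)

lemma not_lepoll_omega_mem_omega:
  assumes "n \<epsilon> omega"
  shows "\<not> lepoll omega n"
  using assms
proof (rule omega_induct)
  show "definable (\<lambda>e. \<not> lepoll omega (e 0))" by (intro definable)
  show "\<not> lepoll omega emp" using lepollE emp_omega by (metis mem_emp)
next
  fix n assume n: "n \<epsilon> omega" "\<not> lepoll omega n"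
  show "\<not> lepoll omega (succ n)"
  proof
    assume "lepoll omega (succ n)"
    then obtain g where g: "dterm (\<lambda>e. g (e 0))" "\<And>x. x \<epsilon> omega \<Longrightarrow> g x \<epsilon> succ n"
      "\<And>x y. x \<epsilon> omega \<Longrightarrow> y \<epsilon> omega \<Longrightarrow> g x = g y \<Longrightarrow> x = y"
      using lepollE by blast
    \<comment> \<open>The shift drops \<open>g emp\<close> from the range; by injectivity that value
      is free and can replace \<open>n\<close> wherever \<open>n\<close> occurs.\<close>
    define h where "h i = (if g (succ i) = n then g emp else g (succ i))" for i
    have ne: "g (succ i) \<noteq> g emp"
      if "i \<epsilon> omega" for i using g(3) that emp_omega succ_omega by (metis succ_not_emp(1))
    have "lepoll omega n"
    proof (rule lepollI[of h])
      show "dterm (\<lambda>e. h (e 0))" unfolding h_def by (intro definable dterm_sub1[OF g(1)])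
      show "h i \<epsilon> n" if "i \<epsilon> omega" for i
        using g(2)[of emp] g(2)[of "succ i"] ne[OF that] that by (auto simp: h_def)
      show "i = j" if "i \<epsilon> omega" "j \<epsilon> omega" "h i = h j" for i j
        using ne[OF that(1)] ne[OF that(2)] g(3)[of "succ i" "succ j"] that
        by (auto simp: h_def split: if_splits)
    qed
    with n(2) show False by blast
  qed
qed

text \<open>A countable set is finite or denumerable, and the pigeonhole principle just proved
  excludes the finite case.\<close>

lemma DenumerableI: "lepoll omega a \<Longrightarrow> lepoll a omega \<Longrightarrow> Denumerable a"
  using countable_iff_lepoll_omega not_lepoll_omega_mem_omega lepoll_trans eqpoll_lepoll eqpoll_sym
  unfolding Finite_def by blast

text \<open>A preimage for each \<open>y\<close> is selected without choice, as the one with the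
  least number under \<open>h\<close>; \<open>k y\<close> is that number.\<close>

lemma lepoll_omega_img:
  assumes g: "dterm (\<lambda>e. g (e 0))" and "lepoll a omega"
  shows "lepoll (img a g) omega"
proof -
  obtain h where h: "dterm (\<lambda>e. h (e 0))" "\<And>x. x \<epsilon> a \<Longrightarrow> h x \<epsilon> omega"
    "\<And>x y. x \<epsilon> a \<Longrightarrow> y \<epsilon> a \<Longrightarrow> h x = h y \<Longrightarrow> x = y"
    using lepollE[OF assms(2)] by blast
  define k where "k y = least_omega (\<lambda>n. \<exists>x. x \<epsilon> a \<and> h x = n \<and> g x = y)" for y
  have k: "k y \<epsilon> omega \<and> (\<exists>x. x \<epsilon> a \<and> h x = k y \<and> g x = y)" if y: "y \<epsilon> img a g" for y
  proof -
    have D: "definable (\<lambda>e. \<exists>x. x \<epsilon> a \<and> h x = e 0 \<and> g x = y)"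
      by (intro definable dterm_sub1[OF h(1)] dterm_sub1[OF g])
    obtain x where x: "x \<epsilon> a" "g x = y" using y unfolding mem_img[OF g] by metis
    have P: "\<exists>z. z \<epsilon> a \<and> h z = h x \<and> g z = y" using x by blast
    from least_omega(1,2)[where P = "\<lambda>n. \<exists>x. x \<epsilon> a \<and> h x = n \<and> g x = y", OF D h(2)[OF x(1)] P]
    show ?thesis unfolding k_def by blast
  qed
  show ?thesis
  proof (rule lepollI[of k])
    show "dterm (\<lambda>e. k (e 0))"
      unfolding k_def by (intro definable dterm_sub1[OF h(1)] dterm_sub1[OF g])
    show "k y \<epsilon> omega" if "y \<epsilon> img a g" for y using k[OF that] by blast
    show "x = y" if "x \<epsilon> img a g" "y \<epsilon> img a g" "k x = k y" for x y
      using k[OF that(1)] k[OF that(2)] that(3) h(3) by metis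
  qed
qed

lemma lepoll_omega_Sub: "Sub a b \<Longrightarrow> lepoll b omega \<Longrightarrow> lepoll a omega"
  using lepoll_Sub lepoll_trans by blast

text \<open>\<open>D\<close> is doubling: elements of \<open>a\<close> receive even codes, the other
  elements of \<open>b\<close> odd ones.\<close>

lemma lepoll_omega_cup:
  assumes "lepoll a omega" "lepoll b omega"
  shows "lepoll (cup a b) omega"
proof -
  have "dterm (\<lambda>e. succ (succ (e 1)))" by (intro definable)
  from recursion[where G = "\<lambda>_ x. succ (succ x)", OF this]
  obtain D where D: "dterm (\<lambda>e. D (e 0))" "D emp = emp"
    "\<And>n. n \<epsilon> omega \<Longrightarrow> D (succ n) = succ (succ (D n))"
    by blast
  have omega: "D n \<epsilon> omega" if "n \<epsilon> omega" for n
    using that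
  proof (rule omega_induct)
    show "definable (\<lambda>e. D (e 0) \<epsilon> omega)" by (intro definable D(1))
  qed (simp_all add: D(2,3))
  have mono: "\<forall>k. k \<epsilon> n \<longrightarrow> D k \<epsilon> D n" if "n \<epsilon> omega" for n
    using that
  proof (rule omega_induct)
    show "definable (\<lambda>e. \<forall>k. k \<epsilon> e 0 \<longrightarrow> D k \<epsilon> D (e 0))" by (intro definable dterm_sub1[OF D(1)])
  qed (auto simp: D(2,3))
  have inj: "m = n" if "m \<epsilon> omega" "n \<epsilon> omega" "D m = D n" for m n
    using omega_linear[OF that(1,2)] mono that by (metis mem_irrefl)
  \<comment> \<open>No even number is odd. Cancelling successors in
    \<open>D (succ m) = succ (D n)\<close> leads to the same kind of equation for \<open>m\<close>
    and the predecessor of \<open>n\<close>.\<close>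
  have parity: "\<forall>n. n \<epsilon> omega \<longrightarrow> D m \<noteq> succ (D n)" if "m \<epsilon> omega" for m
    using that
  proof (rule omega_induct)
    show "definable (\<lambda>e. \<forall>n. n \<epsilon> omega \<longrightarrow> D (e 0) \<noteq> succ (D n))"
      by (intro definable dterm_sub1[OF D(1)])
    show "\<forall>n. n \<epsilon> omega \<longrightarrow> D emp \<noteq> succ (D n)" by (simp add: D(2))
    fix m assume m: "m \<epsilon> omega" "\<forall>n. n \<epsilon> omega \<longrightarrow> D m \<noteq> succ (D n)"
    show "\<forall>n. n \<epsilon> omega \<longrightarrow> D (succ m) \<noteq> succ (D n)"
    proof (intro allI impI)
      fix n assume "n \<epsilon> omega"
      then show "D (succ m) \<noteq> succ (D n)"
        using omega_cases[of n] m by (auto simp: D(2,3))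
    qed
  qed
  obtain f where f: "dterm (\<lambda>e. f (e 0))" "\<And>x. x \<epsilon> a \<Longrightarrow> f x \<epsilon> omega"
    "\<And>x y. x \<epsilon> a \<Longrightarrow> y \<epsilon> a \<Longrightarrow> f x = f y \<Longrightarrow> x = y"
    using lepollE[OF assms(1)] by blast
  obtain g where g: "dterm (\<lambda>e. g (e 0))" "\<And>x. x \<epsilon> b \<Longrightarrow> g x \<epsilon> omega"
    "\<And>x y. x \<epsilon> b \<Longrightarrow> y \<epsilon> b \<Longrightarrow> g x = g y \<Longrightarrow> x = y"
    using lepollE[OF assms(2)] by blast
  show ?thesis
  proof (rule lepollI[of "\<lambda>x. if x \<epsilon> a then D (f x) else succ (D (g x))"])
    show "dterm (\<lambda>e. if e 0 \<epsilon> a then D (f (e 0)) else succ (D (g (e 0))))"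
      by (intro definable dterm_sub1[OF D(1)] f(1) g(1))
    show "(if x \<epsilon> a then D (f x) else succ (D (g x))) \<epsilon> omega" if "x \<epsilon> cup a b" for x
      using that f(2) g(2) omega by auto
    show "x = y" if "x \<epsilon> cup a b" "y \<epsilon> cup a b"
      "(if x \<epsilon> a then D (f x) else succ (D (g x))) = (if y \<epsilon> a then D (f y) else succ (D (g y)))" for x y
    proof -
      have ne: "D (f u) \<noteq> succ (D (g v))" if "u \<epsilon> a" "v \<epsilon> b" for u v
        using parity[OF f(2)[OF that(1)]] g(2)[OF that(2)] by blast
      consider "x \<epsilon> a" "y \<epsilon> a" | "x \<epsilon> a" "\<not> y \<epsilon> a" "y \<epsilon> b" | "\<not> x \<epsilon> a" "x \<epsilon> b" "y \<epsilon> a"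
        | "\<not> x \<epsilon> a" "x \<epsilon> b" "\<not> y \<epsilon> a" "y \<epsilon> b"
        using \<open>x \<epsilon> cup a b\<close> \<open>y \<epsilon> cup a b\<close> by auto
      then show ?thesis
      proof cases
        case 1
        then show ?thesis using that(3) inj[of "f x" "f y"] f(2,3) by simp
      next
        case 2
        then show ?thesis using that(3) ne[of x y] by simp
      next
        case 3
        then show ?thesis using that(3) ne[of y x] by simp
      next
        case 4
        then show ?thesis using that(3) inj[of "g x" "g y"] g(2,3) by simp
      qed
    qed
  qed
qed

text \<open>Written as an image of the number two, so that \<open>x = y\<close> is no special
  case.\<close>

lemma lepoll_omega_upair: "lepoll (upair x y) omega"
proof -
  define h where "h n = (if n = emp then x else y)" for n
  have h: "dterm (\<lambda>e. h (e 0))" unfolding h_def by (intro definable)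
  have "Finite (succ (succ emp))"
    unfolding Finite_def using eqpoll_refl emp_omega succ_omega by blast
  then have "lepoll (img (succ (succ emp)) h) omega"
    using lepoll_omega_img[OF h] lepoll_omega_if_countable by blast
  moreover have "h emp = x" "h (succ emp) = y" by (simp_all add: h_def)
  then have "Sub (upair x y) (img (succ (succ emp)) h)"
    unfolding Sub_def mem_img[OF h] mem_upair mem_succ by metis
  ultimately show ?thesis using lepoll_omega_Sub by blast
qed

text \<open>
  The family is padded so that it and its members become infinite: \<open>omega\<close> is added to the members,
  and the sets \<open>omega - {n}\<close> to the family.
\<close>

lemma lepoll_omega_un:
  assumes UT: "\<And>A. Denumerable A \<Longrightarrow> (\<And>a. a \<epsilon> A \<Longrightarrow> Denumerable a) \<Longrightarrow> Denumerable (un A)"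
    and "lepoll A omega" "\<And>a. a \<epsilon> A \<Longrightarrow> lepoll a omega"
  shows "lepoll (un A) omega"
proof -
  define co where "co n = sep omega (\<lambda>x. x \<noteq> n)" for n
  have co: "x \<epsilon> co n \<longleftrightarrow> x \<epsilon> omega \<and> x \<noteq> n" for x n
    unfolding co_def by (rule mem_sep) (intro definable)
  have co_dterm: "dterm (\<lambda>e. co (e 0))" unfolding co_def by (intro definable)
  have cup_dterm: "dterm (\<lambda>e. cup (e 0) omega)" by (intro definable)
  define B where "B = cup (img A (\<lambda>a. cup a omega)) (img omega co)"
  have B: "b \<epsilon> B \<longleftrightarrow> (\<exists>a. a \<epsilon> A \<and> b = cup a omega) \<or> (\<exists>n. n \<epsilon> omega \<and> b = co n)" for b
    unfolding B_def by (simp add: mem_img[OF co_dterm] mem_img[OF cup_dterm])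
  have "Denumerable B"
  proof (rule DenumerableI)
    show "lepoll B omega"
      unfolding B_def
        by (intro lepoll_omega_cup lepoll_omega_img co_dterm cup_dterm assms(2) lepoll_refl)
    show "lepoll omega B"
    proof (rule lepollI[of co])
      show "m = n"
        if "m \<epsilon> omega" "n \<epsilon> omega" "co m = co n" for m n using co[of m m] co[of m n] that by auto
    qed (use co_dterm B in blast)+
  qed
  moreover have "Denumerable b" if b: "b \<epsilon> B" for b
  proof (rule DenumerableI)
    have co_lepoll: "lepoll omega (co n)" if "n \<epsilon> omega" for n
    \<comment> \<open>Numbers below \<open>n\<close> stay and the others move up by one, which
      leaves out exactly \<open>n\<close>.\<close>
    proof (rule lepollI[of "\<lambda>x. if x \<epsilon> n then x else succ x"])
      show "dterm (\<lambda>e. if e 0 \<epsilon> n then e 0 else succ (e 0))" by (intro definable)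
      show "(if x \<epsilon> n then x else succ x) \<epsilon> co n" if "x \<epsilon> omega" for x using that by (auto simp: co)
      show "x = y" if "x \<epsilon> omega" "y \<epsilon> omega"
        "(if x \<epsilon> n then x else succ x) = (if y \<epsilon> n then y else succ y)" for x y
        using that omega_trans[of x y n] omega_trans[of y x n] \<open>n \<epsilon> omega\<close>
        by (auto split: if_splits)
    qed
    have "Sub omega (cup a omega)" for a by (simp add: Sub_def)
    then show "lepoll omega b" using b B co_lepoll lepoll_Sub by metis
    have "lepoll (co n) omega" for n by (rule lepoll_Sub) (simp add: Sub_def co)
    then show "lepoll b omega" using b B assms(3) lepoll_omega_cup lepoll_refl by metis
  qed
  ultimately have "Denumerable (un B)" by (rule UT)
  then have "lepoll (un B) omega" using lepoll_omega_if_countable by blast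
  moreover have "Sub (un A) (un B)" unfolding Sub_def mem_un B by (metis mem_cup)
  ultimately show ?thesis using lepoll_omega_Sub by blast
qed

section \<open>Graphs in a model\<close>

definition Adj :: "'a \<Rightarrow> 'a \<Rightarrow> 'a \<Rightarrow> bool" where
  "Adj E x y \<longleftrightarrow> upair x y \<epsilon> E"

definition Graph :: "'a \<Rightarrow> 'a \<Rightarrow> bool" where
  "Graph V E \<longleftrightarrow> (\<forall>e. e \<epsilon> E \<longrightarrow> (\<exists>x y. x \<epsilon> V \<and> y \<epsilon> V \<and> x \<noteq> y \<and> e = upair x y))"

definition Locally_countable :: "'a \<Rightarrow> 'a \<Rightarrow> bool" where
  "Locally_countable V E \<longleftrightarrow> (\<forall>v. v \<epsilon> V \<longrightarrow>
    (\<forall>N. (\<forall>x. x \<epsilon> N \<longleftrightarrow> x \<epsilon> V \<and> Adj E v x) \<longrightarrow> Finite N \<or> Denumerable N))"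

definition Path :: "'a \<Rightarrow> 'a \<Rightarrow> 'a \<Rightarrow> 'a \<Rightarrow> 'a \<Rightarrow> 'a \<Rightarrow> bool" where
  "Path V E n p x y \<longleftrightarrow> Injection p (succ n) V \<and> pair emp x \<epsilon> p \<and> pair n y \<epsilon> p \<and>
    (\<forall>i j u v. i \<epsilon> n \<and> j = succ i \<and> pair i u \<epsilon> p \<and> pair j v \<epsilon> p \<longrightarrow> Adj E u v)"

definition Reach :: "'a \<Rightarrow> 'a \<Rightarrow> 'a \<Rightarrow> 'a \<Rightarrow> bool" where
  "Reach V E x y \<longleftrightarrow> (\<exists>n p. n \<epsilon> omega \<and> Path V E n p x y)"

definition Connected :: "'a \<Rightarrow> 'a \<Rightarrow> bool" where
  "Connected V E \<longleftrightarrow> (\<forall>x y. x \<epsilon> V \<and> y \<epsilon> V \<longrightarrow> Reach V E x y)"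

definition Independent :: "'a \<Rightarrow> 'a \<Rightarrow> 'a \<Rightarrow> bool" where
  "Independent V E I \<longleftrightarrow> Sub I V \<and> (\<forall>x y. x \<epsilon> I \<and> y \<epsilon> I \<longrightarrow> \<not> Adj E x y)"

definition Maximal_independent :: "'a \<Rightarrow> 'a \<Rightarrow> 'a \<Rightarrow> bool" where
  "Maximal_independent V E I \<longleftrightarrow> Independent V E I \<and>
    \<not> (\<exists>J. Independent V E J \<and> Sub I J \<and> I \<noteq> J)"

section \<open>Adjacency and paths\<close>

lemma Adj_definable [definable]:
  "dterm s \<Longrightarrow> dterm t \<Longrightarrow> dterm u \<Longrightarrow> definable (\<lambda>e. Adj (s e) (t e) (u e))"
  unfolding Adj_def by (intro definable)

lemma Adj_sym: "Adj E x y \<Longrightarrow> Adj E y x"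
  unfolding Adj_def using upair_eq by metis

lemma Adj_vertices:
  assumes "Graph V E" "Adj E x y"
  shows "x \<epsilon> V" "y \<epsilon> V" "x \<noteq> y"
proof -
  obtain u v where "u \<epsilon> V" "v \<epsilon> V" "u \<noteq> v" "upair x y = upair u v"
    using assms unfolding Graph_def Adj_def by blast
  then show "x \<epsilon> V" "y \<epsilon> V" "x \<noteq> y" by (auto simp: upair_eq)
qed

lemma Path_lamI:
  assumes h: "dterm (\<lambda>e. h (e 0))" and n: "n \<epsilon> omega"
    and V: "\<And>i. i \<epsilon> succ n \<Longrightarrow> h i \<epsilon> V"
    and inj: "\<And>i j. i \<epsilon> succ n \<Longrightarrow> j \<epsilon> succ n \<Longrightarrow> h i = h j \<Longrightarrow> i = j"
    and adj: "\<And>i. i \<epsilon> n \<Longrightarrow> Adj E (h i) (h (succ i))"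
  shows "Path V E n (lam (succ n) h) (h emp) (h n)"
proof -
  have "Function (lam (succ n) h) (succ n) V" by (rule Function_lam[OF h V])
  then have "Injection (lam (succ n) h) (succ n) V"
    unfolding Injection_def pair_mem_lam[OF h] using inj by blast
  then show ?thesis
    using adj emp_mem_succ[OF n] by (auto simp: Path_def pair_mem_lam[OF h])
qed

lemma PathD:
  assumes "Path V E n p x y" "n \<epsilon> omega"
  shows "\<And>i. i \<epsilon> succ n \<Longrightarrow> ap p i \<epsilon> V"
    and "\<And>i j. i \<epsilon> succ n \<Longrightarrow> j \<epsilon> succ n \<Longrightarrow> ap p i = ap p j \<Longrightarrow> i = j"
    and "ap p emp = x" and "ap p n = y"
    and "\<And>i. i \<epsilon> n \<Longrightarrow> Adj E (ap p i) (ap p (succ i))"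
proof -
  have F: "Function p (succ n) V" using assms(1) by (simp add: Path_def Injection_def)
  note p = Function_ap[OF F]
  show "ap p i \<epsilon> V" if "i \<epsilon> succ n" for i using p(2) that .
  show "i = j" if "i \<epsilon> succ n" "j \<epsilon> succ n" "ap p i = ap p j" for i j
  proof -
    have "pair i (ap p i) \<epsilon> p" "pair j (ap p i) \<epsilon> p" using that by (simp_all add: p(1))
    then show ?thesis using assms(1) unfolding Path_def Injection_def by blast
  qed
  show "ap p emp = x" "ap p n = y" using assms(1) by (simp_all add: Path_def p(1))
  show "Adj E (ap p i) (ap p (succ i))" if "i \<epsilon> n" for i
  proof -
    have "pair i (ap p i) \<epsilon> p" "pair (succ i) (ap p (succ i)) \<epsilon> p"
      using that succ_mem_succ[OF that assms(2)] by (simp_all add: p(1))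
    then show ?thesis using assms(1) that unfolding Path_def by blast
  qed
qed

lemma Reach_refl:
  assumes "x \<epsilon> V"
  shows "Reach V E x x"
proof -
  have "Path V E emp (lam (succ emp) (\<lambda>_. x)) x x"
    by (rule Path_lamI[of "\<lambda>_. x"]) (use assms in \<open>auto intro: definable\<close>)
  then show ?thesis unfolding Reach_def using emp_omega by blast
qed

text \<open>Paths are injective, so \<open>z\<close> cannot always be appended. If it already
  occurs, the path is cut off at its position \<open>k\<close>.\<close>

lemma Reach_step:
  assumes "Reach V E x y" "Adj E y z" "z \<epsilon> V"
  shows "Reach V E x z"
proof -
  obtain n p where n: "n \<epsilon> omega" and "Path V E n p x y" using assms(1) unfolding Reach_def by blast
  note p = PathD[OF this(2) n]
  show ?thesis
  proof (cases "\<exists>k. k \<epsilon> succ n \<and> ap p k = z")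
    case True
    then obtain k where k: "k \<epsilon> succ n" "ap p k = z" by blast
    have k_omega: "k \<epsilon> omega" using omega_mem[OF k(1)] n by simp
    have sub: "i \<epsilon> succ n" if "i \<epsilon> succ k" for i
      using that k(1) omega_trans[of i k "succ n"] n by auto
    have sub': "i \<epsilon> n" if "i \<epsilon> k" for i using that k(1) omega_trans[of i k n] n by auto
    have "Path V E k (lam (succ k) (ap p)) (ap p emp) (ap p k)"
    proof (rule Path_lamI)
      show "dterm (\<lambda>e. ap p (e 0))" by (intro definable)
      show "k \<epsilon> omega" by (rule k_omega)
      show "ap p i \<epsilon> V" if "i \<epsilon> succ k" for i using p(1) sub[OF that] .
      show "i = j" if "i \<epsilon> succ k" "j \<epsilon> succ k" "ap p i = ap p j" for i j
        using p(2)[OF sub[OF that(1)] sub[OF that(2)] that(3)] .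
      show "Adj E (ap p i) (ap p (succ i))" if "i \<epsilon> k" for i using p(5) sub'[OF that] .
    qed
    then show ?thesis unfolding Reach_def using k_omega p(3) k(2) by metis
  next
    case False
    define h where "h i = (if i = succ n then z else ap p i)" for i
    have ne: "i \<noteq> succ n" if "i \<epsilon> succ n" for i using that by (metis mem_irrefl)
    have hp: "h i = ap p i" if "i \<epsilon> succ n" for i using ne[OF that] by (simp add: h_def)
    have hz: "h (succ n) = z" by (simp add: h_def)
    have "Path V E (succ n) (lam (succ (succ n)) h) (h emp) (h (succ n))"
    proof (rule Path_lamI)
      show "dterm (\<lambda>e. h (e 0))" unfolding h_def by (intro definable)
      show "succ n \<epsilon> omega" using n by simp
      show "h i \<epsilon> V" if "i \<epsilon> succ (succ n)" for i
        using that p(1) assms(3) hp hz mem_succ[of i "succ n"] by metis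
      show "i = j" if "i \<epsilon> succ (succ n)" "j \<epsilon> succ (succ n)" "h i = h j" for i j
        using that p(2) False hp hz mem_succ[of _ "succ n"] by metis
      show "Adj E (h i) (h (succ i))" if i: "i \<epsilon> succ n" for i
      proof (cases "i = n")
        case True
        then show ?thesis using hp[OF i] hz p(4) assms(2) by simp
      next
        case False
        then have "i \<epsilon> n" using i by simp
        then show ?thesis using hp[OF i] hp[OF succ_mem_succ] n p(5) by simp
      qed
    qed
    moreover have "h emp = x" using hp[OF emp_mem_succ[OF n]] p(3) by simp
    ultimately show ?thesis unfolding Reach_def using n hz succ_omega by metis
  qed
qed

text \<open>Otherwise \<open>v\<close> could be added to \<open>I\<close>; the absence of loops
  takes care of the pair of \<open>v\<close> with itself.\<close>

lemma Maximal_independent_neighbour: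
  assumes "Graph V E" "Maximal_independent V E I" "v \<epsilon> V" "\<not> v \<epsilon> I"
  shows "\<exists>u. u \<epsilon> I \<and> Adj E u v"
proof (rule ccontr)
  assume no: "\<not> ?thesis"
  define J where "J = cup I (upair v v)"
  have J: "x \<epsilon> J \<longleftrightarrow> x \<epsilon> I \<or> x = v" for x by (simp add: J_def)
  have I: "Sub I V" "\<And>x y. x \<epsilon> I \<Longrightarrow> y \<epsilon> I \<Longrightarrow> \<not> Adj E x y"
    and max: "\<And>J. Independent V E J \<Longrightarrow> Sub I J \<Longrightarrow> I = J"
    using assms(2) unfolding Maximal_independent_def Independent_def by blast+
  have "\<not> Adj E x y" if "x \<epsilon> J" "y \<epsilon> J" for x y
    using that I(2) no Adj_sym Adj_vertices(3)[OF assms(1)] unfolding J by metis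
  then have "Independent V E J"
    using I(1) assms(3) by (auto simp: Independent_def Sub_def J)
  moreover have "Sub I J" by (simp add: Sub_def J)
  ultimately have "I = J" by (rule max)
  then show False using assms(4) J by blast
qed

text \<open>\<open>F n\<close> is the set of endpoints of walks of length \<open>n\<close> from
  \<open>v\<close>. Its countability is a definable property of \<open>n\<close>, proved by
  induction after the sets have been built, so no enumeration of a level enters the
  recursion.\<close>

lemma countable_if_connected:
  assumes UT: "\<And>A. Denumerable A \<Longrightarrow> (\<And>a. a \<epsilon> A \<Longrightarrow> Denumerable a) \<Longrightarrow> Denumerable (un A)"
    and "Graph V E" "Locally_countable V E" "Connected V E" and v: "v \<epsilon> V"
  shows "lepoll V omega"
proof -
  define N where "N x = sep V (\<lambda>y. Adj E x y)" for x
  have N: "y \<epsilon> N x \<longleftrightarrow> y \<epsilon> V \<and> Adj E x y" for x y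
    unfolding N_def by (rule mem_sep) (intro definable)
  have N_dterm: "dterm (\<lambda>e. N (s e))" if "dterm s" for s
    by (rule dterm_sub1[OF _ that]) (unfold N_def, intro definable)
  have N_omega: "lepoll (N x) omega" if "x \<epsilon> V" for x
    using assms(3) that N countable_iff_lepoll_omega unfolding Locally_countable_def by blast
  have "dterm (\<lambda>e. un (img (e 1) N))" by (intro definable N_dterm)
  from recursion[where G = "\<lambda>_ x. un (img x N)", OF this]
  obtain F where F: "dterm (\<lambda>e. F (e 0))" "F emp = upair v v"
    "\<And>n. n \<epsilon> omega \<Longrightarrow> F (succ n) = un (img (F n) N)" by blast
  have F_succ: "y \<epsilon> F (succ n) \<longleftrightarrow> (\<exists>x. x \<epsilon> F n \<and> y \<epsilon> N x)" if "n \<epsilon> omega" for n y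
    using mem_img[OF N_dterm[OF dterm_var]] by (auto simp: F(3)[OF that] mem_un)
  have "Sub (F n) V \<and> lepoll (F n) omega" if "n \<epsilon> omega" for n
    using that
  proof (rule omega_induct)
    show "definable (\<lambda>e. Sub (F (e 0)) V \<and> lepoll (F (e 0)) omega)" by (intro definable F(1))
    show "Sub (F emp) V \<and> lepoll (F emp) omega"
      using v lepoll_omega_upair by (simp add: F(2) Sub_def)
    fix n assume n: "n \<epsilon> omega" "Sub (F n) V \<and> lepoll (F n) omega"
    have "lepoll (un (img (F n) N)) omega"
    proof (rule lepoll_omega_un[OF UT])
      show "lepoll (img (F n) N) omega"
        using n(2) by (intro lepoll_omega_img N_dterm definable) blast
      show "lepoll a omega" if "a \<epsilon> img (F n) N" for a
        using that N_omega n(2) mem_img[OF N_dterm[OF dterm_var]] by (auto simp: Sub_def)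
    qed
    then show "Sub (F (succ n)) V \<and> lepoll (F (succ n)) omega"
      using F(3)[OF n(1)] F_succ[OF n(1)] N by (auto simp: Sub_def)
  qed
  note F_omega = conjunct2[OF this]
  have "lepoll (un (img omega F)) omega"
  proof (rule lepoll_omega_un[OF UT])
    show "lepoll (img omega F) omega" by (intro lepoll_omega_img F(1) lepoll_refl)
    show "lepoll a omega" if "a \<epsilon> img omega F" for a
      using that F_omega mem_img[OF F(1)] by auto
  qed
  moreover have "Sub V (un (img omega F))"
    unfolding Sub_def
  proof (intro allI impI)
    fix y assume "y \<epsilon> V"
    then obtain n p where n: "n \<epsilon> omega" and "Path V E n p v y"
      using assms(4) v unfolding Connected_def Reach_def by blast
    note p = PathD[OF this(2) n]
    \<comment> \<open>The \<open>i\<close>-th vertex of the path is reached after \<open>i\<close>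
      steps; the premise keeps \<open>i\<close> within the path.\<close>
    have "i \<epsilon> succ n \<longrightarrow> ap p i \<epsilon> F i" if "i \<epsilon> omega" for i
      using that
    proof (rule omega_induct)
      show "definable (\<lambda>e. e 0 \<epsilon> succ n \<longrightarrow> ap p (e 0) \<epsilon> F (e 0))" by (intro definable F(1))
      show "emp \<epsilon> succ n \<longrightarrow> ap p emp \<epsilon> F emp" by (simp add: p(3) F(2))
      fix i assume i: "i \<epsilon> omega" "i \<epsilon> succ n \<longrightarrow> ap p i \<epsilon> F i"
      show "succ i \<epsilon> succ n \<longrightarrow> ap p (succ i) \<epsilon> F (succ i)"
      proof
        assume si: "succ i \<epsilon> succ n"
        then have "i \<epsilon> n" using omega_trans[of i "succ i" n] n by auto
        then show "ap p (succ i) \<epsilon> F (succ i)"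
          using i p(1)[OF si] p(5) F_succ N by auto
      qed
    qed
    then have "y \<epsilon> F n" using n p(4) by auto
    then show "y \<epsilon> un (img omega F)" using n mem_img[OF F(1)] by (auto simp: mem_un)
  qed
  ultimately show ?thesis using lepoll_omega_Sub by blast
qed

text \<open>At stage \<open>n\<close> the vertex numbered \<open>n\<close>, if there is one, is
  tested against the set \<open>K n\<close> collected so far. The numbering \<open>j\<close> is a
  single object and makes every decision definable.\<close>

lemma maximal_independent_if_countable:
  assumes "Graph V E" "lepoll V omega"
  shows "\<exists>I. Maximal_independent V E I"
proof -
  obtain j where j: "dterm (\<lambda>e. j (e 0))" "\<And>x. x \<epsilon> V \<Longrightarrow> j x \<epsilon> omega"
    "\<And>x y. x \<epsilon> V \<Longrightarrow> y \<epsilon> V \<Longrightarrow> j x = j y \<Longrightarrow> x = y"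
    using lepollE[OF assms(2)] by blast
  define G where "G n s = cup s (sep V (\<lambda>v. j v = n \<and> (\<forall>u. u \<epsilon> s \<longrightarrow> \<not> Adj E u v)))" for n s
  have G: "v \<epsilon> G n s \<longleftrightarrow> v \<epsilon> s \<or> v \<epsilon> V \<and> j v = n \<and> (\<forall>u. u \<epsilon> s \<longrightarrow> \<not> Adj E u v)" for v n s
    unfolding G_def mem_cup by (subst mem_sep, intro definable j(1), rule refl)
  have "dterm (\<lambda>e. G (e 0) (e 1))" unfolding G_def by (intro definable dterm_sub1[OF j(1)])
  from recursion[where G = G, OF this]
  obtain K where K: "dterm (\<lambda>e. K (e 0))" "K emp = emp" "\<And>n. n \<epsilon> omega \<Longrightarrow> K (succ n) = G n (K n)"
    by blast
  have K_dterm: "dterm (\<lambda>e. K (s e))" if "dterm s" for s using dterm_sub1[OF K(1) that] .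
  have j_dterm: "dterm (\<lambda>e. j (s e))" if "dterm s" for s using dterm_sub1[OF j(1) that] .
  have mono: "\<forall>m. m \<epsilon> n \<longrightarrow> Sub (K m) (K n)" if "n \<epsilon> omega" for n
    using that
  proof (rule omega_induct)
    show "definable (\<lambda>e. \<forall>m. m \<epsilon> e 0 \<longrightarrow> Sub (K m) (K (e 0)))" by (intro definable K_dterm)
  qed (auto simp: K(3) G Sub_def)
  have mono: "x \<epsilon> K n" if "x \<epsilon> K m" "m \<epsilon> n \<or> m = n" "n \<epsilon> omega" for m n x
    using mono[OF that(3)] that by (auto simp: Sub_def)
  \<comment> \<open>Records that \<open>v\<close> was accepted at stage \<open>j v\<close> and what
    it was tested against. Since the clauses refer to \<open>j v\<close>, later stages do not
    disturb them.\<close>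
  have K_props: "\<forall>v. v \<epsilon> K n \<longrightarrow> v \<epsilon> V \<and> j v \<epsilon> n \<and> v \<epsilon> K (succ (j v)) \<and>
      (\<forall>u. u \<epsilon> K (j v) \<longrightarrow> \<not> Adj E u v)" if "n \<epsilon> omega" for n
    using that
  proof (rule omega_induct)
    show "definable (\<lambda>e. \<forall>v. v \<epsilon> K (e 0) \<longrightarrow> v \<epsilon> V \<and> j v \<epsilon> e 0 \<and> v \<epsilon> K (succ (j v)) \<and>
        (\<forall>u. u \<epsilon> K (j v) \<longrightarrow> \<not> Adj E u v))" by (intro definable K_dterm j_dterm)
  qed (auto simp: K(2,3) G)
  define I where "I = un (img omega K)"
  have I: "x \<epsilon> I \<longleftrightarrow> (\<exists>n. n \<epsilon> omega \<and> x \<epsilon> K n)" for x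
    unfolding I_def mem_un mem_img[OF K(1)] by blast
  have I_props: "v \<epsilon> V" "v \<epsilon> K (succ (j v))" "\<And>u. u \<epsilon> K (j v) \<Longrightarrow> \<not> Adj E u v" if "v \<epsilon> I" for v
    using that K_props unfolding I by blast+
  \<comment> \<open>The member with the smaller number had already been collected when the other one
    was tested.\<close>
  have not_less: "\<not> Adj E u v" if "u \<epsilon> I" "v \<epsilon> I" "j u \<epsilon> j v" for u v
  proof -
    have "j v \<epsilon> omega" using j(2) I_props(1)[OF that(2)] .
    then have "succ (j u) \<epsilon> succ (j v)" using succ_mem_succ that(3) by blast
    then have "u \<epsilon> K (j v)" using mono[OF I_props(2)[OF that(1)], of "j v"] \<open>j v \<epsilon> omega\<close> by simp
    then show ?thesis using I_props(3)[OF that(2)] by blast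
  qed
  have indep: "\<not> Adj E u v" if uv: "u \<epsilon> I" "v \<epsilon> I" for u v
  proof
    assume a: "Adj E u v"
    have "j u \<noteq> j v" using j(3) I_props(1) uv Adj_vertices(3)[OF assms(1) a] by blast
    then have "j u \<epsilon> j v \<or> j v \<epsilon> j u" using omega_linear j(2) I_props(1) uv by blast
    then show False using not_less uv a Adj_sym by blast
  qed
  have "I = J" if J: "Independent V E J" "Sub I J" for J
  proof (rule extensionality)
    fix v
    have "v \<epsilon> I" if v: "v \<epsilon> J"
    proof -
      have vV: "v \<epsilon> V" using J(1) v by (auto simp: Independent_def Sub_def)
      \<comment> \<open>Everything that \<open>v\<close> was tested against belongs to
        \<open>I\<close>, hence to the independent set \<open>J\<close> that contains
        \<open>v\<close>. So the test was passed at stage \<open>j v\<close>.\<close>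
      have "\<not> Adj E u v" if "u \<epsilon> K (j v)" for u
      proof -
        have "u \<epsilon> J" using J(2) that I j(2)[OF vV] unfolding Sub_def by blast
        then show ?thesis using J(1) v unfolding Independent_def by blast
      qed
      then have "v \<epsilon> K (succ (j v))" using vV by (simp add: K(3)[OF j(2)[OF vV]] G)
      then show ?thesis using I j(2)[OF vV] succ_omega by blast
    qed
    then show "v \<epsilon> I \<longleftrightarrow> v \<epsilon> J" using J(2) by (auto simp: Sub_def)
  qed
  moreover have "Independent V E I"
    using indep I_props(1) by (auto simp: Independent_def Sub_def)
  ultimately show ?thesis unfolding Maximal_independent_def by blast
qed

theorem UT_imp_maximal_independent:
  assumes "\<And>A. Denumerable A \<Longrightarrow> (\<And>a. a \<epsilon> A \<Longrightarrow> Denumerable a) \<Longrightarrow> Denumerable (un A)"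
    and "Graph V E" "Locally_countable V E" "Connected V E"
  shows "\<exists>I. Maximal_independent V E I"
proof (cases "\<exists>v. v \<epsilon> V")
  case True
  then show ?thesis
    using countable_if_connected[OF assms] maximal_independent_if_countable[OF assms(2)] by blast
next
  \<comment> \<open>The empty graph offers no starting vertex, but its vertex set is trivially
    countable.\<close>
  case False
  then have "Sub V omega" by (auto simp: Sub_def)
  then show ?thesis using maximal_independent_if_countable[OF assms(2)] lepoll_Sub by blast
qed

text \<open>
  The graph has the vertices \<open>(a, x)\<close> with \<open>a \<in> A\<close> and \<open>x \<in> a \<union> {a}\<close>. For each \<open>a\<close> they form a
  clique, and so do the hubs \<open>(a, a)\<close>. A maximal independent set contains at most one hub; it
  chooses an element from every other member of \<open>A\<close>.
\<close>

theorem maximal_independent_imp_choice: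
  assumes P: "\<And>V E. Graph V E \<Longrightarrow> Locally_countable V E \<Longrightarrow> Connected V E \<Longrightarrow>
      \<exists>I. Maximal_independent V E I"
    and A: "Denumerable A" "\<And>a. a \<epsilon> A \<Longrightarrow> Denumerable a"
  shows "\<exists>f. Function f A (un A) \<and> (\<forall>a y. a \<epsilon> A \<and> pair a y \<epsilon> f \<longrightarrow> y \<epsilon> a)"
proof -
  have A_omega: "lepoll A omega" and a_omega: "\<And>a. a \<epsilon> A \<Longrightarrow> lepoll a omega"
    using A lepoll_omega_if_countable by blast+
  have nonempty: "\<exists>x. x \<epsilon> a" if "a \<epsilon> A" for a
    using A(2)[OF that] eqpollE emp_omega unfolding Denumerable_def by metis
  have row_dterm: "dterm (\<lambda>e. pair a (e 0))" for a by (intro definable)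
  have rows_dterm: "dterm (\<lambda>e. img (succ (e 0)) (\<lambda>x. pair (e 0) x))" by (intro definable)
  define V where "V = un (img A (\<lambda>a. img (succ a) (\<lambda>x. pair a x)))"
  have V: "p \<epsilon> V \<longleftrightarrow> (\<exists>a x. a \<epsilon> A \<and> x \<epsilon> succ a \<and> p = pair a x)" for p
    unfolding V_def mem_un mem_img[OF rows_dterm] using mem_img[OF row_dterm] by blast
  \<comment> \<open>Two different vertices are joined if they lie in the same clique or are both
    hubs.\<close>
  define R where "R p q \<longleftrightarrow>
    p \<noteq> q \<and> (\<exists>a x b y. p = pair a x \<and> q = pair b y \<and> (a = b \<or> x = a \<and> y = b))" for p q
  define E where "E = sep (pow V) (\<lambda>e. \<exists>p q. p \<epsilon> V \<and> q \<epsilon> V \<and> R p q \<and> e = upair p q)"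
  have E: "e \<epsilon> E \<longleftrightarrow> Sub e V \<and> (\<exists>p q. p \<epsilon> V \<and> q \<epsilon> V \<and> R p q \<and> e = upair p q)" for e
    unfolding E_def mem_pow[symmetric] by (rule mem_sep) (unfold R_def, intro definable)
  have R_sym: "R q p" if "R p q" for p q using that unfolding R_def by blast
  have Adj: "Adj E p q \<longleftrightarrow> p \<epsilon> V \<and> q \<epsilon> V \<and> R p q" for p q
    unfolding Adj_def E using R_sym by (auto simp: Sub_def upair_eq)
  have Adj_pair: "Adj E (pair a x) (pair b y) \<longleftrightarrow> a \<epsilon> A \<and> x \<epsilon> succ a \<and> b \<epsilon> A \<and> y \<epsilon> succ b \<and>
      (a \<noteq> b \<or> x \<noteq> y) \<and> (a = b \<or> x = a \<and> y = b)" for a x b y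
    unfolding Adj V R_def by (simp only: pair_eq) metis
  have graph: "Graph V E" unfolding Graph_def E R_def by blast
  have "Locally_countable V E"
    unfolding Locally_countable_def
  proof (intro allI impI)
    fix v N assume "v \<epsilon> V" and N: "\<forall>x. x \<epsilon> N \<longleftrightarrow> x \<epsilon> V \<and> Adj E v x"
    then obtain a x where v: "a \<epsilon> A" "v = pair a x" unfolding V by blast
    \<comment> \<open>Whether or not \<open>v\<close> is a hub, its neighbours lie in its own
      clique, the row of \<open>a\<close>, or among the hubs. Both sets are countable.\<close>
    define row where "row y = pair a y" for y
    define hub where "hub b = pair b b" for b
    have row_dterm: "dterm (\<lambda>e. row (e 0))" unfolding row_def by (intro definable)
    have hub_dterm: "dterm (\<lambda>e. hub (e 0))" unfolding hub_def by (intro definable)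
    have "lepoll (succ a) omega"
      unfolding succ_def by (rule lepoll_omega_cup[OF a_omega[OF v(1)] lepoll_omega_upair])
    then have "lepoll (cup (img (succ a) row) (img A hub)) omega"
      using lepoll_omega_cup lepoll_omega_img[OF row_dterm] lepoll_omega_img[OF hub_dterm A_omega] by blast
    moreover have "Sub N (cup (img (succ a) row) (img A hub))"
      unfolding Sub_def mem_cup mem_img[OF row_dterm] mem_img[OF hub_dterm]
    proof (intro allI impI)
      fix p assume "p \<epsilon> N"
      then have "p \<epsilon> V" "Adj E v p" using N by blast+
      then obtain b y where "p = pair b y" "Adj E (pair a x) (pair b y)" using v V by metis
      then show "(\<exists>y. y \<epsilon> succ a \<and> p = row y) \<or> (\<exists>b. b \<epsilon> A \<and> p = hub b)"
        unfolding Adj_pair row_def hub_def by metis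
    qed
    ultimately show "Finite N \<or> Denumerable N"
      using countable_iff_lepoll_omega lepoll_omega_Sub by blast
  qed
  moreover have "Connected V E"
    unfolding Connected_def
  proof (intro allI impI)
    fix p q assume "p \<epsilon> V \<and> q \<epsilon> V"
    then obtain a x b y where pq: "a \<epsilon> A" "x \<epsilon> succ a" "p = pair a x" "b \<epsilon> A" "y \<epsilon> succ b" "q = pair b y"
      unfolding V by blast
    \<comment> \<open>The route is \<open>(a, x)\<close>, \<open>(a, a)\<close>,
      \<open>(b, b)\<close>, \<open>(b, y)\<close>. Consecutive entries may coincide, which the
      equality alternative permits.\<close>
    have step: "Reach V E p (pair c z)"
      if "Reach V E p (pair d w)" "pair d w = pair c z \<or> Adj E (pair d w) (pair c z)"
      for c z d w
      using that Reach_step Adj by metis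
    have "p \<epsilon> V" using \<open>p \<epsilon> V \<and> q \<epsilon> V\<close> ..
    then have "Reach V E p (pair a x)" using Reach_refl pq(3) by blast
    then have "Reach V E p (pair a a)" by (rule step) (use pq in \<open>auto simp: Adj_pair\<close>)
    then have "Reach V E p (pair b b)" by (rule step) (use pq in \<open>auto simp: Adj_pair\<close>)
    then have "Reach V E p (pair b y)" by (rule step) (use pq in \<open>auto simp: Adj_pair\<close>)
    then show "Reach V E p q" using pq(6) by simp
  qed
  ultimately obtain I where I: "Maximal_independent V E I" using P graph by blast
  then have I_V: "p \<epsilon> V" and I_indep: "\<not> Adj E p q" if "p \<epsilon> I" "q \<epsilon> I" for p q
    using that unfolding Maximal_independent_def Independent_def Sub_def by blast+
  have uniq: "x = y" if "pair a x \<epsilon> I" "pair a y \<epsilon> I" for a x y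
  proof (rule ccontr)
    assume "x \<noteq> y"
    moreover have "a \<epsilon> A" "x \<epsilon> succ a" "y \<epsilon> succ a" using I_V that V by (metis pair_eq)+
    ultimately show False using I_indep[OF that] Adj_pair by blast
  qed
  have ex: "\<exists>x. x \<epsilon> a \<and> pair a x \<epsilon> I" if a: "a \<epsilon> A" "\<not> pair a a \<epsilon> I" for a
  proof -
    obtain x where x: "x \<epsilon> a" using nonempty a(1) by blast
    show ?thesis
    proof (cases "pair a x \<epsilon> I")
      case False
      moreover have "pair a x \<epsilon> V" using a(1) x unfolding V by auto
      \<comment> \<open>Since \<open>x\<close> is in \<open>a\<close>, the vertex
        \<open>(a, x)\<close> is not a hub, so this neighbour lies in the clique of
        \<open>a\<close>. It is not the hub either, because the hub is outside
        \<open>I\<close>.\<close>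
      ultimately obtain p where p: "p \<epsilon> I" "Adj E p (pair a x)"
        using Maximal_independent_neighbour[OF graph I] by blast
      then obtain b y where "p = pair b y" using I_V[OF p(1) p(1)] V by blast
      then have "y \<epsilon> succ b \<and> (b = a \<or> y = b \<and> x = a)" and I_by: "pair b y \<epsilon> I"
        using p Adj_pair by simp_all
      moreover have "x \<noteq> a" using x by auto
      ultimately have "b = a" "y \<epsilon> succ a" by auto
      then have "y \<noteq> a" using I_by a(2) by auto
      then show ?thesis using I_by \<open>b = a\<close> \<open>y \<epsilon> succ a\<close> by auto
    qed (use x in blast)
  qed
  \<comment> \<open>Hubs are pairwise adjacent, so at most one \<open>a\<close> is concerned, and
    one element \<open>z\<close> serves as a parameter of the choice function.\<close>
  have "\<exists>z. \<forall>a. a \<epsilon> A \<and> pair a a \<epsilon> I \<longrightarrow> z \<epsilon> a"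
  proof (cases "\<exists>a. a \<epsilon> A \<and> pair a a \<epsilon> I")
    case True
    then obtain a where a: "a \<epsilon> A" "pair a a \<epsilon> I" by blast
    have "b = a" if "b \<epsilon> A" "pair b b \<epsilon> I" for b
      using I_indep[OF that(2) a(2)] that(1) a(1) unfolding Adj_pair by auto
    then show ?thesis using nonempty[OF a(1)] by blast
  qed blast
  then obtain z where z: "\<And>a. a \<epsilon> A \<Longrightarrow> pair a a \<epsilon> I \<Longrightarrow> z \<epsilon> a" by blast
  \<comment> \<open>Uniqueness within a clique makes the chosen element describable, so that
    replacement turns \<open>g\<close> into a set.\<close>
  define g where "g a = (if pair a a \<epsilon> I then z else iota (\<lambda>x. x \<epsilon> a \<and> pair a x \<epsilon> I))" for a
  have g_dterm: "dterm (\<lambda>e. g (e 0))" unfolding g_def by (intro definable)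
  have g: "g a \<epsilon> a" if "a \<epsilon> A" for a
  proof (cases "pair a a \<epsilon> I")
    case True
    then show ?thesis using z that by (simp add: g_def)
  next
    case False
    have "\<exists>!x. x \<epsilon> a \<and> pair a x \<epsilon> I" using ex[OF that False] uniq by blast
    from iotaI[OF this] show ?thesis using False by (simp add: g_def)
  qed
  have "Function (lam A g) A (un A)"
    using g by (intro Function_lam g_dterm) (auto simp: mem_un)
  moreover have "\<forall>a y. a \<epsilon> A \<and> pair a y \<epsilon> lam A g \<longrightarrow> y \<epsilon> a"
    using g by (auto simp: pair_mem_lam[OF g_dterm])
  ultimately show ?thesis by blast
qed

end

section \<open>Interpretation of the formulas\<close>

context zf_model
begin

text \<open>Here and below, a premise such as \<open>x < d\<close> says that the level is bound by
  an enclosing quantifier, so its value is unchanged under further quantifiers.\<close>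

lemma sat_subset:
  "x < d \<Longrightarrow> y < d \<Longrightarrow> sat UNIV mem e ((x \<^bold>\<subseteq> y) d) \<longleftrightarrow> Sub (lv e d x) (lv e d y)"
  by (simp add: f_subset_def Sub_def sat_simps)

lemma sat_empty: "x < d \<Longrightarrow> sat UNIV mem e (is_empty x d) \<longleftrightarrow> lv e d x = emp"
  using emp_eqI by (auto simp: is_empty_def sat_simps)

lemma sat_upair:
  "x < d \<Longrightarrow> y < d \<Longrightarrow> p < d \<Longrightarrow>
    sat UNIV mem e (is_upair x y p d) \<longleftrightarrow> lv e d p = upair (lv e d x) (lv e d y)"
  using upair_eqI by (auto simp: is_upair_def sat_simps)

lemma sat_Union:
  "A < d \<Longrightarrow> u < d \<Longrightarrow> sat UNIV mem e (is_Union A u d) \<longleftrightarrow> lv e d u = un (lv e d A)"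
  using extensionality[of "lv e d u" "un (lv e d A)"] by (auto simp: is_Union_def sat_simps mem_un)

lemma sat_succ:
  "x < d \<Longrightarrow> s < d \<Longrightarrow> sat UNIV mem e (is_succ x s d) \<longleftrightarrow> lv e d s = succ (lv e d x)"
  using extensionality[of "lv e d s" "succ (lv e d x)"] by (auto simp: is_succ_def sat_simps)

lemma sat_opair:
  "x < d \<Longrightarrow> y < d \<Longrightarrow> p < d \<Longrightarrow>
    sat UNIV mem e (is_opair x y p d) \<longleftrightarrow> lv e d p = pair (lv e d x) (lv e d y)"
  by (simp add: is_opair_def sat_simps sat_upair pair_def)

lemma sat_maps_to:
  "f < d \<Longrightarrow> x < d \<Longrightarrow> y < d \<Longrightarrow>
    sat UNIV mem e (maps_to f x y d) \<longleftrightarrow> pair (lv e d x) (lv e d y) \<epsilon> lv e d f"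
  by (simp add: maps_to_def sat_simps sat_opair)

lemma sat_function:
  "f < d \<Longrightarrow> a < d \<Longrightarrow> b < d \<Longrightarrow>
    sat UNIV mem e (is_function f a b d) \<longleftrightarrow> Function (lv e d f) (lv e d a) (lv e d b)"
  by (simp add: is_function_def Function_def sat_simps sat_opair sat_maps_to)

lemma sat_injection:
  "f < d \<Longrightarrow> a < d \<Longrightarrow> b < d \<Longrightarrow>
    sat UNIV mem e (is_injection f a b d) \<longleftrightarrow> Injection (lv e d f) (lv e d a) (lv e d b)"
  by (simp add: is_injection_def Injection_def sat_simps sat_function sat_maps_to)

lemma sat_bijection:
  "f < d \<Longrightarrow> a < d \<Longrightarrow> b < d \<Longrightarrow>
    sat UNIV mem e (is_bijection f a b d) \<longleftrightarrow> Bijection (lv e d f) (lv e d a) (lv e d b)"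
  by (simp add: is_bijection_def Bijection_def sat_simps sat_injection sat_maps_to)

lemma sat_omega: "w < d \<Longrightarrow> sat UNIV mem e (is_omega w d) \<longleftrightarrow> lv e d w = omega"
  using Omega_iff[of "lv e d w"] by (simp add: is_omega_def sat_simps sat_inductive sat_subset)

lemma sat_finite: "a < d \<Longrightarrow> sat UNIV mem e (is_finite a d) \<longleftrightarrow> Finite (lv e d a)"
  by (simp add: is_finite_def Finite_def eqpoll_def sat_simps sat_omega sat_bijection)

lemma sat_denumerable: "a < d \<Longrightarrow> sat UNIV mem e (is_denumerable a d) \<longleftrightarrow> Denumerable (lv e d a)"
  by (simp add: is_denumerable_def Denumerable_def eqpoll_def sat_simps sat_omega sat_bijection)

lemma sat_adjacent:
  "E < d \<Longrightarrow> x < d \<Longrightarrow> y < d \<Longrightarrow>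
    sat UNIV mem e (adjacent E x y d) \<longleftrightarrow> Adj (lv e d E) (lv e d x) (lv e d y)"
  by (simp add: adjacent_def Adj_def sat_simps sat_upair)

lemma sat_graph:
  "V < d \<Longrightarrow> E < d \<Longrightarrow> sat UNIV mem e (is_graph V E d) \<longleftrightarrow> Graph (lv e d V) (lv e d E)"
  by (simp add: is_graph_def Graph_def sat_simps sat_upair)

lemma sat_locally_countable:
  "V < d \<Longrightarrow> E < d \<Longrightarrow>
    sat UNIV mem e (locally_countable V E d) \<longleftrightarrow> Locally_countable (lv e d V) (lv e d E)"
  by (simp add: locally_countable_def Locally_countable_def is_countable_def sat_simps sat_adjacent
      sat_finite sat_denumerable)

lemma sat_path:
  "V < d \<Longrightarrow> E < d \<Longrightarrow> n < d \<Longrightarrow> p < d \<Longrightarrow> x < d \<Longrightarrow> y < d \<Longrightarrow>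
    sat UNIV mem e (is_path V E n p x y d) \<longleftrightarrow>
      Path (lv e d V) (lv e d E) (lv e d n) (lv e d p) (lv e d x) (lv e d y)"
  by (simp add: is_path_def Path_def sat_simps sat_adjacent sat_succ sat_empty sat_injection sat_maps_to)

lemma sat_connected:
  "V < d \<Longrightarrow> E < d \<Longrightarrow>
    sat UNIV mem e (is_connected V E d) \<longleftrightarrow> Connected (lv e d V) (lv e d E)"
  by (simp add: is_connected_def Connected_def Reach_def sat_simps sat_path sat_omega)

lemma sat_independent:
  "V < d \<Longrightarrow> E < d \<Longrightarrow> I < d \<Longrightarrow>
    sat UNIV mem e (is_independent V E I d) \<longleftrightarrow> Independent (lv e d V) (lv e d E) (lv e d I)"
  by (simp add: is_independent_def Independent_def sat_simps sat_adjacent sat_subset)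

lemma sat_maximal_independent:
  "V < d \<Longrightarrow> E < d \<Longrightarrow> I < d \<Longrightarrow>
    sat UNIV mem e (is_maximal_independent V E I d) \<longleftrightarrow>
      Maximal_independent (lv e d V) (lv e d E) (lv e d I)"
  by (simp add: is_maximal_independent_def Maximal_independent_def sat_simps sat_independent sat_subset)

lemma sat_UT_aleph0:
  "sat UNIV mem e UT_aleph0 \<longleftrightarrow>
    (\<forall>A. Denumerable A \<and> (\<forall>a. a \<epsilon> A \<longrightarrow> Denumerable a) \<longrightarrow> Denumerable (un A))"
  by (simp add: UT_aleph0_def sat_simps sat_denumerable sat_Union)

lemma sat_P_lc_c:
  "sat UNIV mem e P_lc_c \<longleftrightarrow>
    (\<forall>V E. Graph V E \<and> Locally_countable V E \<and> Connected V E \<longrightarrow> (\<exists>I. Maximal_independent V E I))"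
  by (simp add: P_lc_c_def sat_simps sat_graph sat_locally_countable sat_connected
      sat_maximal_independent)

lemma sat_AC_aleph0_aleph0:
  "sat UNIV mem e AC_aleph0_aleph0 \<longleftrightarrow>
    (\<forall>A. Denumerable A \<and> (\<forall>a. a \<epsilon> A \<longrightarrow> Denumerable a) \<longrightarrow>
      (\<exists>f. Function f A (un A) \<and> (\<forall>a y. a \<epsilon> A \<and> pair a y \<epsilon> f \<longrightarrow> y \<epsilon> a)))"
  by (simp add: AC_aleph0_aleph0_def sat_simps sat_denumerable sat_Union sat_function sat_maps_to)

lemma sat_UT_imp_P: "sat UNIV mem e (Imp UT_aleph0 P_lc_c)"
  using UT_imp_maximal_independent by (simp add: sat_UT_aleph0 sat_P_lc_c)

lemma sat_P_imp_AC: "sat UNIV mem e (Imp P_lc_c AC_aleph0_aleph0)"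
  using maximal_independent_imp_choice by (simp add: sat_P_lc_c sat_AC_aleph0_aleph0)

end

theorem proposition3p4:
  "ZF \<turnstile> Imp UT_aleph0 P_lc_c \<and> ZF \<turnstile> Imp P_lc_c AC_aleph0_aleph0"
  using ZF_derivableI zf_model.sat_UT_imp_P zf_model.sat_P_imp_AC by blast

end
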